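(* Let $n\ge2$. The map $\psi_D=\varphi_D\circ\phi^{\mathrm{NC}}_D$ is a bijection between $\mathrm{NC}_D(n)$ and $\mathfrak D(n)$. Moreover, if $\psi_D(\pi)=(\sigma,x)$, then $\operatorname{type}(\pi)=\operatorname{type}(\sigma)\,\dot\cup\,\{1\}$ if $x=\emptyset$ or $x$ is an edge; $\operatorname{type}(\pi)=\operatorname{type}(\sigma\setminus\{x\})$ if $x$ is a block; and $\operatorname{type}(\pi)=\operatorname{type}(\sigma\setminus\{B\})\,\dot\cup\,\{|B|+1\}$ if $x\in[\pm(n-1)]$ and $B$ is the block of $\sigma$ containing $|x|$.
   Context: $[m]=\{1,\dots,m\}$, $[\pm m]=\{\pm1,\dots,\pm m\}$, $\Pi(m)$ = set partitions of $[m]$. An edge of a partition of a set of integers is a pair $(i,j)$, $i<j$, in the same block with no element of that block strictly between. $\mathrm{NC}(m)$: partitions of $[m]$ with no two edges $(a,b),(c,d)$, $a<c<b<d$. A block $B$ of $\sigma$ is nonnested if no edge $(i,j)$ satisfies $i<\min B\le\max B<j$. $\mathrm{NC}^{\mathrm{NN}}_{\{0,\pm1\}}(m)$ is the set of triples $(\sigma,X,\epsilon)$ with $\sigma\in\mathrm{NC}(m)$, $X$ a set of nonnested blocks of $\sigma$, $\epsilon\in\{-1,0,1\}$, $\epsilon=0$ if $X=\emptyset$. A partition of type $B_m$ is a set partition of $[\pm m]$ with $-B$ a block whenever $B$ is and at most one block (zero block) with $B=-B$; $\Pi_B(m)$ is their set. $\mathrm{NC}_B(m)$: those $\pi\in\Pi_B(m)$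 with no $i<j<k<l$ such that $a_i,a_k\in B$, $a_j,a_l\in B'$, $B\ne B'$ blocks, where $(a_1,\dots,a_{2m})=(1,\dots,m,-1,\dots,-m)$. For $\pi\in\Pi_B(n)$, $\pi'$ is obtained by merging the blocks containing $n$ or $-n$ and deleting $\pm n$ (discarding an empty block). $\mathrm{NC}_D(n)$: $\pi\in\Pi_B(n)$ such that any zero block $B$ satisfies $\{n,-n\}\subsetneq B$, and $\pi'\in\mathrm{NC}_B(n-1)$. For $\rho\in\mathrm{NC}_B(m)$, $\phi^{\mathrm{NC}}_B(\rho)=(\sigma,X)$: $\sigma$ deletes negative integers, $X$ = blocks of $\sigma$ properly contained in blocks of $\rho$. $\phi^{\mathrm{NC}}_D(\pi)=(\sigma,X,\epsilon)$ for $\pi\in\mathrm{NC}_D(n)$: if $\{n\},\{-n\}$ are blocks or $\pi$ has a zero block, $(\sigma,X)=\phi^{\mathrm{NC}}_B(\pi')$, $\epsilon=0$; otherwise the block of $n$ is $\{a_1,\dots,a_r,-b_1,\dots,-b_s,n\}$ with $a_1<\cdots<a_r<n$, $b_1<\cdots<b_s<n$, $r+s\ge1$; $\epsilon=1$ if $s=0$ or ($r,s>0$ and $a_r<b_s$), else $\epsilon=-1$; $\sigma\in\Pi(n-1)$ has blocks the nonempty sets $B^+\setminus\{n\}$, $B\in\pi$ ($B^+$ = positive elements); $X$ = blocks of $\sigma$ properly contained in blocks of $\pi$. $\mathfrak D(n)$ is the set of pairs $(\sigma,x)$ with $\sigma\in\mathrm{NC}(n-1)$ and $x$ either $\emptyset$,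 an edge of $\sigma$, a block of $\sigma$, or an integer in $[\pm(n-1)]$. For $(\sigma,X,\epsilon)\in\mathrm{NC}^{\mathrm{NN}}_{\{0,\pm1\}}(n-1)$ with $X=\{A_1,\dots,A_k\}$, $\max A_1<\cdots<\max A_k$: $\varphi_D(\sigma,X,\epsilon)=(\sigma',x)$ where $\sigma'$ is obtained from $\sigma$ by merging $A_i$ and $A_{k+1-i}$ for $i=1,\dots,\lfloor k/2\rfloor$, and $x=\emptyset$ if $\epsilon=0,k=0$; $x=(\max A_t,\min A_{t+1})$ if $\epsilon=0$, $k=2t\ne0$; $x=A_{t+1}$ if $\epsilon=0$, $k=2t+1$; $x=\epsilon\cdot\max(A_{\lfloor(k+1)/2\rfloor})$ if $\epsilon\ne0$. Types: type of a collection of sets = multiset of sizes; type of $\pi\in\Pi_B(n)$ = multiset containing $i$ with multiplicity the number of unordered pairs $\{B,-B\}$ of nonzero blocks of size $i$; $\dot\cup$ = multiset union.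
   Formalization: NC_D(n) here also requires that deleting ±n from π without merging gives an element of NC_B(n-1), i.e. the blocks of n and -n do not cross; without this ψ_D is undefined at e.g. n=4, π={{1,3,-2,-4},{-1,-3,2,4}}. *)

theory Defs
  imports Main "HOL-Library.Multiset" "HOL-Library.Disjoint_Sets" "HOL-Library.FuncSet"
begin

text \<open>
  All ground sets are sets of integers and a set partition is the set of its (nonempty) blocks,
  in the sense of \<^const>\<open>partition_on\<close>.
\<close>

section \<open>Noncrossing partitions of [m]\<close>

definition edges :: "int set set \<Rightarrow> (int \<times> int) set" where
  "edges \<sigma> = {(i, j). i < j \<and> (\<exists>B\<in>\<sigma>. i \<in> B \<and> j \<in> B \<and> \<not> (\<exists>k\<in>B. i < k \<and> k < j))}"

definition NC :: "nat \<Rightarrow> int set set set" where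
  "NC m = {\<sigma>. partition_on {1..int m} \<sigma> \<and>
     \<not> (\<exists>a b c d. (a, b) \<in> edges \<sigma> \<and> (c, d) \<in> edges \<sigma> \<and> a < c \<and> c < b \<and> b < d)}"

definition nonnested :: "int set set \<Rightarrow> int set \<Rightarrow> bool" where
  "nonnested \<sigma> B \<longleftrightarrow> \<not> (\<exists>i j. (i, j) \<in> edges \<sigma> \<and> i < Min B \<and> Min B \<le> Max B \<and> Max B < j)"

definition NCNN :: "nat \<Rightarrow> (int set set \<times> int set set \<times> int) set" where
  "NCNN m = {(\<sigma>, X, \<epsilon>). \<sigma> \<in> NC m \<and> X \<subseteq> {B \<in> \<sigma>. nonnested \<sigma> B} \<and>
     \<epsilon> \<in> {-1, 0, 1} \<and> (X = {} \<longrightarrow> \<epsilon> = 0)}"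

section \<open>Noncrossing partitions of types B and D\<close>

definition zero_block :: "int set \<Rightarrow> bool" where
  "zero_block B \<longleftrightarrow> uminus ` B = B"

definition PiB :: "nat \<Rightarrow> int set set set" where
  "PiB m = {\<pi>. partition_on ({- int m..int m} - {0}) \<pi> \<and> (\<forall>B\<in>\<pi>. uminus ` B \<in> \<pi>) \<and>
     (\<forall>B\<in>\<pi>. \<forall>C\<in>\<pi>. zero_block B \<and> zero_block C \<longrightarrow> B = C)}"

text \<open>The circular order 1, ..., m, -1, ..., -m, indexed by 1, ..., 2m.\<close>

definition circ :: "nat \<Rightarrow> nat \<Rightarrow> int" where
  "circ m i = (if i \<le> m then int i else - int (i - m))"

definition NCB :: "nat \<Rightarrow> int set set set" where
  "NCB m = {\<pi> \<in> PiB m. \<not> (\<exists>i j k l. 1 \<le> i \<and> i < j \<and> j < k \<and> k < l \<and> l \<le> 2 * m \<and>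
     (\<exists>B\<in>\<pi>. \<exists>C\<in>\<pi>. B \<noteq> C \<and> circ m i \<in> B \<and> circ m k \<in> B \<and> circ m j \<in> C \<and> circ m l \<in> C))}"

definition merge_pm :: "nat \<Rightarrow> int set set \<Rightarrow> int set set" where
  "merge_pm n \<pi> = ({B \<in> \<pi>. int n \<notin> B \<and> - int n \<notin> B} \<union>
     {\<Union>{B \<in> \<pi>. int n \<in> B \<or> - int n \<in> B} - {int n, - int n}}) - {{}}"

definition delete_pm :: "nat \<Rightarrow> int set set \<Rightarrow> int set set" where
  "delete_pm n \<pi> = (\<lambda>B. B - {int n, - int n}) ` \<pi> - {{}}"

text \<open>
  The condition on \<^const>\<open>merge_pm\<close> does not see whether the blocks of n and -n cross each other,
  since it merges them.  Alone it would admit, for n = 4, the partition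
  {{1,3,-2,-4}, {-1,-3,2,4}}, which is crossing in the circular representation of type D
  (1, ..., n-1, -1, ..., -(n-1) on a circle, n and -n in the centre): there would be 52 partitions
  instead of the 50 noncrossing partitions of type D for n = 4.
  The condition on \<^const>\<open>delete_pm\<close> excludes these crossings and nothing else.
\<close>

definition NCD :: "nat \<Rightarrow> int set set set" where
  "NCD n = {\<pi> \<in> PiB n. (\<forall>B\<in>\<pi>. zero_block B \<longrightarrow> {int n, - int n} \<subset> B) \<and>
     merge_pm n \<pi> \<in> NCB (n - 1) \<and> delete_pm n \<pi> \<in> NCB (n - 1)}"

section \<open>The maps\<close>

definition phiB_NC :: "int set set \<Rightarrow> int set set \<times> int set set" where
  "phiB_NC \<rho> = (let \<sigma> = (\<lambda>B. B \<inter> {0<..}) ` \<rho> - {{}} in (\<sigma>, {A \<in> \<sigma>. \<exists>B\<in>\<rho>. A \<subset> B}))"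

definition phiD_NC :: "nat \<Rightarrow> int set set \<Rightarrow> int set set \<times> int set set \<times> int" where
  "phiD_NC n \<pi> =
    (if ({int n} \<in> \<pi> \<and> {- int n} \<in> \<pi>) \<or> (\<exists>B\<in>\<pi>. zero_block B)
     then (let (\<sigma>, X) = phiB_NC (merge_pm n \<pi>) in (\<sigma>, X, 0))
     else
       (let N = (THE B. B \<in> \<pi> \<and> int n \<in> B);
            as = {a \<in> N. 0 < a \<and> a < int n};
            bs = {b. 0 < b \<and> b < int n \<and> - b \<in> N};
            \<epsilon> = (if bs = {} \<or> (as \<noteq> {} \<and> bs \<noteq> {} \<and> Max as < Max bs) then 1 else -1);
            \<sigma> = (\<lambda>B. (B \<inter> {0<..}) - {int n}) ` \<pi> - {{}}
        in (\<sigma>, {A \<in> \<sigma>. \<exists>B\<in>\<pi>. A \<subset> B}, \<epsilon>)))"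

datatype mark = MEmpty | MEdge "int \<times> int" | MBlock "int set" | MInt int

definition DD :: "nat \<Rightarrow> (int set set \<times> mark) set" where
  "DD n = {(\<sigma>, x). \<sigma> \<in> NC (n - 1) \<and>
     (case x of
        MEmpty \<Rightarrow> True
      | MEdge e \<Rightarrow> e \<in> edges \<sigma>
      | MBlock B \<Rightarrow> B \<in> \<sigma>
      | MInt i \<Rightarrow> i \<in> {- int (n - 1)..int (n - 1)} - {0})}"

definition blocks_by_max :: "int set set \<Rightarrow> int set list" where
  "blocks_by_max X = (THE As. set As = X \<and> sorted_wrt (\<lambda>A B. Max A < Max B) As)"

text \<open>
  The map is \<^const>\<open>undefined\<close> outside its domain \<^term>\<open>NCNN (n - 1)\<close>.
\<close>

definition varphiD :: "nat \<Rightarrow> int set set \<times> int set set \<times> int \<Rightarrow> int set set \<times> mark" where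
  "varphiD n = restrict (\<lambda>(\<sigma>, X, \<epsilon>).
     let k = card X;
         A = (\<lambda>i. blocks_by_max X ! (i - 1));
         \<sigma>' = (\<sigma> - (\<Union>i\<in>{1..k div 2}. {A i, A (k + 1 - i)}))
               \<union> (\<lambda>i. A i \<union> A (k + 1 - i)) ` {1..k div 2};
         x = (if \<epsilon> = 0 then
                if k = 0 then MEmpty
                else if even k then MEdge (Max (A (k div 2)), Min (A (k div 2 + 1)))
                else MBlock (A (k div 2 + 1))
              else MInt (\<epsilon> * Max (A ((k + 1) div 2))))
     in (\<sigma>', x)) (NCNN (n - 1))"

definition psiD :: "nat \<Rightarrow> int set set \<Rightarrow> int set set \<times> mark" where
  "psiD n = varphiD n \<circ> phiD_NC n"

section \<open>Types\<close>

definition type_of :: "int set set \<Rightarrow> nat multiset" where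
  "type_of \<sigma> = image_mset card (mset_set \<sigma>)"

definition typeB :: "int set set \<Rightarrow> nat multiset" where
  "typeB \<pi> = (\<Sum>i\<in>card ` \<pi>.
     replicate_mset (card {{B, uminus ` B} | B. B \<in> \<pi> \<and> \<not> zero_block B \<and> card B = i}) i)"

end

theory Submission imports Defs begin

text \<open>
  If \<open>\<psi>\<^sub>D(\<pi>) = (\<sigma>, x)\<close>, then the blocks of \<open>\<sigma>\<close> are the sets of absolute values of the blocks of \<open>\<pi>\<close>,
  with \<open>n\<close> removed, and \<open>x\<close> encodes a diameter of the circle \<open>1, \<dots>, n-1, -1, \<dots>, -(n-1)\<close> together with
  the position of \<open>n\<close> and \<open>-n\<close>.  The diameter separates \<open>p\<close> from its successor, where \<open>p\<close> is \<open>0\<close>, the left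
  end of the edge, the maximum of the block or the absolute value of the integer \<open>x\<close>.  Noncrossing means
  that, apart from the zero block, each block of \<open>\<pi>\<close> without \<open>\<plusminus>n\<close> lies on one side of this diameter,
  and each of the two half circles is a rotated copy of \<open>1, \<dots>, n-1\<close>.  So \<open>\<pi>\<close> is recovered from
  \<open>(\<sigma>, x)\<close> by lifting every block of \<open>\<sigma>\<close> to both half circles and attaching \<open>n\<close> and \<open>-n\<close>; since lifting
  preserves block sizes, this also gives the types.
\<close>

section \<open>Noncrossing partitions through betweenness\<close>

text \<open>\<open>psiD\<close> is evaluated only on explicit lifts, where it returns the given
  pair. Since every element of \<open>NCD n\<close> is a lift, injectivity follows without comparing
  two choices of p. A block of \<sigma> containing elements on both sides of p is cut by the
  diameter into two positive pieces, and \<open>varphiD\<close> must reassemble it. Such blocks are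
  nested around p, so in the order of maxima the pieces read B1, ..., Bt, Bt, ..., B1: this is why
  entry i is merged with entry k+1-i, and why the middle of the list locates p. The sign \<epsilon>
  is readable because the lower piece of a block containing p has maximum p, below that of the upper
  piece; comparing the two maxima tells which half circle the lift attached to n comes from. For a
  zero block the positive part is the whole block of \<sigma>, not two pieces. It fits the same
  scheme only if the block has nothing beyond p, so p is taken to be its maximum.\<close>

definition between :: "int \<Rightarrow> int \<Rightarrow> int \<Rightarrow> bool" where
  "between a c b \<longleftrightarrow> a < b \<and> b < c \<or> c < b \<and> b < a"

text \<open>
  The condition says that no element of one block separates two elements of another one in the order
  given by \<open>k\<close>.  In this form it does not change when the order is rotated.
\<close>

definition noncrossing :: "('a \<Rightarrow> int) \<Rightarrow> 'a set set \<Rightarrow> bool" where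
  "noncrossing k P \<longleftrightarrow> (\<forall>B\<in>P. \<forall>C\<in>P. B \<noteq> C \<longrightarrow>
     (\<forall>a\<in>B. \<forall>c\<in>B. \<forall>b\<in>C. \<forall>d\<in>C. between (k a) (k c) (k b) = between (k a) (k c) (k d)))"

lemma noncrossingD:
  assumes "noncrossing k P" "B \<in> P" "C \<in> P" "B \<noteq> C" "a \<in> B" "c \<in> B" "b \<in> C" "d \<in> C"
  shows "between (k a) (k c) (k b) = between (k a) (k c) (k d)"
  by (rule assms(1)[unfolded noncrossing_def, rule_format, OF assms(2-)])

lemma partition_on_eq:
  assumes "partition_on A P" "B \<in> P" "C \<in> P" "x \<in> B" "x \<in> C"
  shows "B = C"
  using assms unfolding partition_on_def disjoint_def by blast

text \<open>If exactly one of b, d lies between a and c, the four values alternate between the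
  blocks once sorted. The alternation may start in either block, hence \<open>nr1\<close> and
  \<open>nr2\<close>; injectivity of k excludes ties.\<close>

lemma noncrossing_iff:
  assumes P: "partition_on A P" and k: "inj_on k A"
  shows "noncrossing k P \<longleftrightarrow> \<not> (\<exists>a b c d. \<exists>B\<in>P. \<exists>C\<in>P. B \<noteq> C \<and> a \<in> B \<and> c \<in> B \<and> b \<in> C \<and> d \<in> C \<and>
    k a < k b \<and> k b < k c \<and> k c < k d)" (is "?l \<longleftrightarrow> \<not> ?r")
proof
  show "\<not> ?r" if ?l
  proof
    assume ?r
    then obtain a b c d B C where *: "B \<in> P" "C \<in> P" "B \<noteq> C" "a \<in> B" "c \<in> B" "b \<in> C" "d \<in> C"
      "k a < k b" "k b < k c" "k c < k d" by blast
    from noncrossingD[OF that *(1-7)] * show False by (auto simp: between_def)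
  qed
  show ?l if nr: "\<not> ?r"
    unfolding noncrossing_def
  proof (intro ballI impI)
    fix B C a c b d
    assume *: "B \<in> P" "C \<in> P" "B \<noteq> C" "a \<in> B" "c \<in> B" "b \<in> C" "d \<in> C"
    have ne: "k x \<noteq> k y" if "x \<in> B" "y \<in> C" for x y
    proof -
      have "x \<in> A" "y \<in> A" using that * P by (auto simp: partition_on_def)
      moreover have "x \<noteq> y" using partition_on_eq[OF P *(1,2)] *(3) that by blast
      ultimately show ?thesis using k by (auto dest: inj_onD)
    qed
    have nr1: "\<not> (k x < k y \<and> k y < k z \<and> k z < k w)" if "x \<in> B" "y \<in> C" "z \<in> B" "w \<in> C" for x y z w
      using nr * that by blast
    have nr2: "\<not> (k y < k x \<and> k x < k w \<and> k w < k z)" if "x \<in> B" "y \<in> C" "z \<in> B" "w \<in> C" for x y z w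
      using nr * that by blast
    show "between (k a) (k c) (k b) = between (k a) (k c) (k d)"
      using ne[of a b] ne[of a d] ne[of c b] ne[of c d] *
        nr1[of a b c d] nr1[of c b a d] nr1[of a d c b] nr1[of c d a b]
        nr2[of a b c d] nr2[of c b a d] nr2[of a d c b] nr2[of c d a b]
      unfolding between_def by (smt (verit))
  qed
qed

lemma partition_on_finite_block:
  assumes "partition_on A P" "finite A" "B \<in> P"
  shows "finite B"
  using assms by (metis Union_upper finite_subset partition_onD1)

text \<open>The edge joins the nearest elements of B on either side of x. It serves to shrink an
  arbitrary pair around x to an edge around x.\<close>

lemma edges_neighbours:
  assumes "B \<in> P" "finite B" "a \<in> B" "c \<in> B" "a < x" "x < c" "x \<notin> B"
  obtains i j where "(i, j) \<in> edges P" "i \<in> B" "j \<in> B" "a \<le> i" "i < x" "x < j" "j \<le> c"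
proof -
  let ?i = "Max {y \<in> B. y < x}" and ?j = "Min {y \<in> B. x < y}"
  have f: "finite {y \<in> B. y < x}" "finite {y \<in> B. x < y}" using assms by auto
  have i: "?i \<in> {y \<in> B. y < x}" using Max_in[OF f(1)] assms by blast
  have j: "?j \<in> {y \<in> B. x < y}" using Min_in[OF f(2)] assms by blast
  have ai: "a \<le> ?i" using Max_ge[OF f(1)] assms by auto
  have jc: "?j \<le> c" using Min_le[OF f(2)] assms by auto
  have "\<not> (\<exists>k\<in>B. ?i < k \<and> k < ?j)"
  proof
    assume "\<exists>k\<in>B. ?i < k \<and> k < ?j"
    then obtain k where k: "k \<in> B" "?i < k" "k < ?j" by blast
    have "\<not> k < x" using Max_ge[OF f(1), of k] k by auto
    moreover have "\<not> x < k" using Min_le[OF f(2), of k] k by auto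
    ultimately show False using k assms by force
  qed
  hence "(?i, ?j) \<in> edges P" using i j assms(1) unfolding edges_def by auto
  thus thesis using i j ai jc that by blast
qed

text \<open>Crossing edges belong to different blocks, since an edge has no element of its own block
  inside. Conversely, for a < b < c < d alternating, the pair a, c shrinks to an edge (i, j) around
  b, and then the pair b, d to an edge around j; these two edges cross.\<close>

lemma NC_iff: "\<sigma> \<in> NC m \<longleftrightarrow> partition_on {1..int m} \<sigma> \<and> noncrossing (\<lambda>x. x) \<sigma>"
proof -
  have "(\<exists>a b c d. (a, b) \<in> edges \<sigma> \<and> (c, d) \<in> edges \<sigma> \<and> a < c \<and> c < b \<and> b < d) \<longleftrightarrow>
     (\<exists>a b c d. \<exists>B\<in>\<sigma>. \<exists>C\<in>\<sigma>. B \<noteq> C \<and> a \<in> B \<and> c \<in> B \<and> b \<in> C \<and> d \<in> C \<and> a < b \<and> b < c \<and> c < d)"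
    (is "?l \<longleftrightarrow> ?r") if P: "partition_on {1..int m} \<sigma>"
  proof
    assume ?l
    then obtain a b c d B C where "a < c" "c < b" "b < d" "a \<in> B" "b \<in> B" "c \<in> C" "d \<in> C" "B \<in> \<sigma>" "C \<in> \<sigma>"
       "\<not> (\<exists>k\<in>B. a < k \<and> k < b)" unfolding edges_def by blast
    moreover from this have "B \<noteq> C" by blast
    ultimately show ?r by blast
  next
    assume ?r
    then obtain a b c d B C where *: "B \<in> \<sigma>" "C \<in> \<sigma>" "B \<noteq> C" "a \<in> B" "c \<in> B" "b \<in> C" "d \<in> C" "a < b" "b < c" "c < d"
      by blast
    have fin: "finite B" "finite C" using partition_on_finite_block[OF P] * by auto
    have disj: "x \<notin> C" if "x \<in> B" for x using partition_on_eq[OF P] * that by blast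
    obtain i j where ij: "(i, j) \<in> edges \<sigma>" "i \<in> B" "j \<in> B" "i < b" "b < j" "j \<le> c"
      using edges_neighbours[OF *(1) fin(1) *(4,5,8,9)] disj *(6) by blast
    have jd: "j < d" using ij(6) *(10) by linarith
    obtain i' j' where ij': "(i', j') \<in> edges \<sigma>" "b \<le> i'" "i' < j" "j < j'"
      using edges_neighbours[OF *(2) fin(2) *(6,7) ij(5) jd disj[OF ij(3)]] by blast
    have "i < i'" using ij(4) ij'(2) by linarith
    thus ?l using ij(1) ij' by blast
  qed
  hence "partition_on {1..int m} \<sigma> \<Longrightarrow>
     \<not> (\<exists>a b c d. (a, b) \<in> edges \<sigma> \<and> (c, d) \<in> edges \<sigma> \<and> a < c \<and> c < b \<and> b < d) \<longleftrightarrow> noncrossing (\<lambda>x. x) \<sigma>"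
    by (subst noncrossing_iff[of "{1..int m}"]) (simp_all only: inj_on_id2)
  thus ?thesis unfolding NC_def by blast
qed

text \<open>The inverse of \<open>circ m\<close>: the position of a nonzero integer on the
  circle.\<close>

definition cpos :: "nat \<Rightarrow> int \<Rightarrow> int" where
  "cpos m x = (if 0 < x then x else int m - x)"

lemma NCB_iff: "\<pi> \<in> NCB m \<longleftrightarrow> \<pi> \<in> PiB m \<and> noncrossing (cpos m) \<pi>"
proof -
  have "(\<exists>i j k l. 1 \<le> i \<and> i < j \<and> j < k \<and> k < l \<and> l \<le> 2 * m \<and>
     (\<exists>B\<in>\<pi>. \<exists>C\<in>\<pi>. B \<noteq> C \<and> circ m i \<in> B \<and> circ m k \<in> B \<and> circ m j \<in> C \<and> circ m l \<in> C)) \<longleftrightarrow>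
     (\<exists>a b c d. \<exists>B\<in>\<pi>. \<exists>C\<in>\<pi>. B \<noteq> C \<and> a \<in> B \<and> c \<in> B \<and> b \<in> C \<and> d \<in> C \<and>
       cpos m a < cpos m b \<and> cpos m b < cpos m c \<and> cpos m c < cpos m d)" (is "?l \<longleftrightarrow> ?r")
    if P: "partition_on ({- int m..int m} - {0}) \<pi>"
  proof
    have c1: "cpos m (circ m i) = int i" if "1 \<le> i" "i \<le> 2 * m" for i
      using that by (auto simp: cpos_def circ_def)
    assume ?l
    then obtain i j k l B C where *: "1 \<le> i" "i < j" "j < k" "k < l" "l \<le> 2 * m"
      "B\<in>\<pi>" "C\<in>\<pi>" "B \<noteq> C" "circ m i \<in> B" "circ m k \<in> B" "circ m j \<in> C" "circ m l \<in> C" by blast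
    have "cpos m (circ m i) < cpos m (circ m j)" "cpos m (circ m j) < cpos m (circ m k)"
      "cpos m (circ m k) < cpos m (circ m l)" using * c1 by auto
    thus ?r using *(6-12) by blast
  next
    assume ?r
    then obtain a b c d B C where *: "B \<in> \<pi>" "C \<in> \<pi>" "B \<noteq> C" "a \<in> B" "c \<in> B" "b \<in> C" "d \<in> C"
      "cpos m a < cpos m b" "cpos m b < cpos m c" "cpos m c < cpos m d" by blast
    have r: "circ m (nat (cpos m x)) = x \<and> 1 \<le> cpos m x \<and> cpos m x \<le> 2 * int m" if "x \<in> D" "D \<in> \<pi>" for x D
    proof -
      have "x \<in> {- int m..int m} - {0}" using that partition_onD1[OF P] by blast
      thus ?thesis by (auto simp: cpos_def circ_def)
    qed
    note R = r[OF *(4,1)] r[OF *(5,1)] r[OF *(6,2)] r[OF *(7,2)]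
    have "1 \<le> nat (cpos m a)" "nat (cpos m a) < nat (cpos m b)" "nat (cpos m b) < nat (cpos m c)"
      "nat (cpos m c) < nat (cpos m d)" "nat (cpos m d) \<le> 2 * m" using R *(8-10) by auto
    moreover have "circ m (nat (cpos m a)) \<in> B" "circ m (nat (cpos m c)) \<in> B"
      "circ m (nat (cpos m b)) \<in> C" "circ m (nat (cpos m d)) \<in> C" using R *(4-7) by simp_all
    ultimately show ?l using *(1-3) by blast
  qed
  moreover have "inj_on (cpos m) ({- int m..int m} - {0})"
    by (auto simp: inj_on_def cpos_def split: if_splits)
  ultimately have "partition_on ({- int m..int m} - {0}) \<pi> \<Longrightarrow>
     \<not> (\<exists>i j k l. 1 \<le> i \<and> i < j \<and> j < k \<and> k < l \<and> l \<le> 2 * m \<and>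
     (\<exists>B\<in>\<pi>. \<exists>C\<in>\<pi>. B \<noteq> C \<and> circ m i \<in> B \<and> circ m k \<in> B \<and> circ m j \<in> C \<and> circ m l \<in> C)) \<longleftrightarrow>
     noncrossing (cpos m) \<pi>"
    by (subst noncrossing_iff[of "{- int m..int m} - {0}"]) (simp_all only:)
  note main = this
  show ?thesis
  proof (cases "\<pi> \<in> PiB m")
    case True
    hence P: "partition_on ({- int m..int m} - {0}) \<pi>" unfolding PiB_def by blast
    show ?thesis unfolding NCB_def mem_Collect_eq main[OF P] ..
  qed (simp add: NCB_def)
qed

section \<open>Half circles and symmetric lifts\<close>

text \<open>For 0 \<le> p \<le> m the image of 1, ..., m is the arc read cyclically as -(p+1), ...,
  -m, 1, ..., p. At p = 0 it consists of the negative integers.\<close>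

definition flip :: "int \<Rightarrow> int \<Rightarrow> int" where
  "flip p i = (if i \<le> p then i else - i)"

definition sym_lift :: "(int \<Rightarrow> int) \<Rightarrow> int set set \<Rightarrow> int set set" where
  "sym_lift f T = (\<Union>B\<in>T. {f ` B, uminus ` f ` B})"

text \<open>Discarding the empty set lets \<open>K = {}\<close> stand for "no zero block", so that
  the plain lift is a special case.\<close>

definition sym_merge :: "int \<Rightarrow> int set set \<Rightarrow> int set \<Rightarrow> int set set" where
  "sym_merge p \<sigma> K = sym_lift (flip p) (\<sigma> - {K}) \<union> ({{x. \<bar>x\<bar> \<in> K}} - {{}})"

text \<open>A right inverse of the absolute value, that is, a choice of signs. It is more general
  than \<open>flip p\<close> because n may receive either sign.\<close>

definition section_on :: "int set \<Rightarrow> (int \<Rightarrow> int) \<Rightarrow> bool" where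
  "section_on U f \<longleftrightarrow> (\<forall>x\<in>U. 0 < x \<and> \<bar>f x\<bar> = x)"

lemma section_on_flip: "U \<subseteq> {0<..} \<Longrightarrow> section_on U (flip p)"
  by (auto simp: section_on_def flip_def)

lemma section_on_subset: "section_on U f \<Longrightarrow> V \<subseteq> U \<Longrightarrow> section_on V f"
  by (auto simp: section_on_def)

lemma mem_section_image:
  assumes "section_on B f"
  shows "x \<in> f ` B \<longleftrightarrow> \<bar>x\<bar> \<in> B \<and> f \<bar>x\<bar> = x"
    and "x \<in> uminus ` f ` B \<longleftrightarrow> \<bar>x\<bar> \<in> B \<and> f \<bar>x\<bar> = - x"
  using assms unfolding section_on_def by (force simp: image_iff)+

lemma section_inj: "section_on U f \<Longrightarrow> inj_on f U"
  unfolding section_on_def inj_on_def by metis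

lemma uminus_image_twice [simp]: "uminus ` uminus ` B = (B :: int set)"
  by (force simp: image_iff)

lemma mem_uminus_image: "x \<in> uminus ` B \<longleftrightarrow> - x \<in> (B :: int set)"
  by (force simp: image_iff)

lemma section_image_nonzero:
  assumes "section_on B f" "B \<noteq> {}"
  shows "f ` B \<noteq> uminus ` f ` B"
proof -
  obtain b where b: "b \<in> B" using assms by blast
  have "f b \<notin> uminus ` f ` B" using mem_section_image(2)[OF assms(1)] assms(1) b
    unfolding section_on_def by force
  thus ?thesis using b by blast
qed

lemma section_image_eq:
  assumes "section_on U f" "B \<subseteq> U" "C \<subseteq> U"
    "f ` B = f ` C \<or> f ` B = uminus ` f ` C \<or> uminus ` f ` B = f ` C \<or> uminus ` f ` B = uminus ` f ` C"
  shows "B = C"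
proof -
  have *: "abs ` f ` D = D" "abs ` uminus ` f ` D = D" if "D \<subseteq> U" for D
    using assms(1) that unfolding section_on_def by (force simp: image_iff)+
  show ?thesis using assms(4) *[OF assms(2)] *[OF assms(3)] by metis
qed

text \<open>The block of x is determined by the block of \<bar>x\<bar> and by which of x, -x is the
  value of f at \<bar>x\<bar>. These two cases exclude each other because x is not 0.\<close>

lemma partition_on_sym_lift:
  assumes P: "partition_on U T" and f: "section_on U f"
  shows "partition_on {x. \<bar>x\<bar> \<in> U} (sym_lift f T)"
proof (rule partition_onI)
  have sub: "section_on B f" if "B \<in> T" for B
    using P f that by (metis partition_onD1 Sup_upper section_on_subset)
  show "{} \<notin> sym_lift f T"
    using P unfolding sym_lift_def partition_on_def by blast
  show "\<Union> (sym_lift f T) = {x. \<bar>x\<bar> \<in> U}"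
  proof (intro equalityI subsetI)
    fix x assume "x \<in> \<Union> (sym_lift f T)"
    then obtain B where B: "B \<in> T" "x \<in> f ` B \<or> x \<in> uminus ` f ` B" unfolding sym_lift_def by blast
    thus "x \<in> {x. \<bar>x\<bar> \<in> U}" using mem_section_image[OF sub[OF B(1)]] P by (auto simp: partition_on_def)
  next
    fix x assume "x \<in> {x. \<bar>x\<bar> \<in> U}"
    hence x: "\<bar>x\<bar> \<in> U" by simp
    then obtain B where B: "B \<in> T" "\<bar>x\<bar> \<in> B" using P by (auto simp: partition_on_def)
    have "f \<bar>x\<bar> = x \<or> f \<bar>x\<bar> = - x" using f x unfolding section_on_def by (metis abs_eq_iff)
    hence "x \<in> f ` B \<or> x \<in> uminus ` f ` B" using mem_section_image[OF sub[OF B(1)]] B by blast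
    thus "x \<in> \<Union> (sym_lift f T)" using B unfolding sym_lift_def by blast
  qed
  show "disjnt E E'" if E: "E \<in> sym_lift f T" "E' \<in> sym_lift f T" "E \<noteq> E'" for E E'
  proof (rule ccontr)
    assume "\<not> disjnt E E'"
    then obtain x where x: "x \<in> E" "x \<in> E'" by (auto simp: disjnt_def)
    obtain B where B: "B \<in> T" "E = f ` B \<or> E = uminus ` f ` B" using E unfolding sym_lift_def by blast
    obtain C where C: "C \<in> T" "E' = f ` C \<or> E' = uminus ` f ` C" using E unfolding sym_lift_def by blast
    note mB = mem_section_image[OF sub[OF B(1)]] and mC = mem_section_image[OF sub[OF C(1)]]
    have sgn: "E = f ` B \<and> f \<bar>x\<bar> = x \<or> E = uminus ` f ` B \<and> f \<bar>x\<bar> = - x"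
      "E' = f ` C \<and> f \<bar>x\<bar> = x \<or> E' = uminus ` f ` C \<and> f \<bar>x\<bar> = - x"
      and "\<bar>x\<bar> \<in> B" "\<bar>x\<bar> \<in> C" using x B(2) C(2) mB mC by blast+
    hence eq: "B = C" using partition_on_eq[OF P B(1) C(1)] by blast
    have "x \<noteq> 0" using sub[OF B(1)] \<open>\<bar>x\<bar> \<in> B\<close> unfolding section_on_def by fastforce
    thus False using sgn E(3) eq by auto
  qed
qed

lemma sym_lift_uminus: "E \<in> sym_lift f T \<Longrightarrow> uminus ` E \<in> sym_lift f T"
proof -
  assume "E \<in> sym_lift f T"
  then obtain B where B: "B \<in> T" "E = f ` B \<or> E = uminus ` f ` B" unfolding sym_lift_def by blast
  from B(2) have "uminus ` E = uminus ` f ` B \<or> uminus ` E = f ` B" by (metis uminus_image_twice)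
  thus ?thesis using B(1) unfolding sym_lift_def by blast
qed

lemma sym_lift_not_zero:
  assumes "partition_on U T" "section_on U f" "E \<in> sym_lift f T"
  shows "\<not> zero_block E"
proof -
  obtain B where B: "B \<in> T" "E = f ` B \<or> E = uminus ` f ` B" using assms unfolding sym_lift_def by blast
  have "section_on B f" "B \<noteq> {}" using assms B by (auto simp: partition_on_def intro: section_on_subset)
  note ne = section_image_nonzero[OF this]
  from B(2) show ?thesis
  proof
    assume E: "E = f ` B"
    show ?thesis unfolding zero_block_def E using ne[symmetric] .
  next
    assume E: "E = uminus ` f ` B"
    show ?thesis unfolding zero_block_def E uminus_image_twice using ne .
  qed
qed

lemma zero_block_sym: "zero_block {x. \<bar>x\<bar> \<in> K}"
  unfolding zero_block_def by (auto simp: mem_uminus_image)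

lemma partition_on_remove:
  assumes "partition_on U T" "K = {} \<or> K \<in> T"
  shows "partition_on (U - K) (T - {K})"
proof (cases "K = {}")
  case True
  thus ?thesis using assms by (simp add: partition_on_def)
next
  case False
  hence K: "K \<in> T" using assms by blast
  have "\<Union> (T - {K}) = U - K" using partition_on_eq[OF assms(1) _ K] assms(1) K
    by (auto simp: partition_on_def)
  thus ?thesis using assms(1) by (auto simp: partition_on_def disjoint_def)
qed

lemma partition_on_Un:
  "partition_on A P \<Longrightarrow> partition_on B Q \<Longrightarrow> A \<inter> B = {} \<Longrightarrow> partition_on (A \<union> B) (P \<union> Q)"
  unfolding partition_on_def disjoint_def by (auto; blast)

lemma abs_interval: "{x. \<bar>x\<bar> \<in> {1..int m}} = {- int m..int m} - {0}"
  by auto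

lemma PiB_sym_lift_union:
  assumes P: "partition_on U T" and f: "section_on U f" and UV: "U \<inter> V = {}" "U \<union> V = {1..int m}"
  shows "sym_lift f T \<union> ({{x. \<bar>x\<bar> \<in> V}} - {{}}) \<in> PiB m"
proof -
  let ?Z = "{{x. \<bar>x\<bar> \<in> V}} - {{}}"
  have eq: "{- int m..int m} - {0} = {x. \<bar>x\<bar> \<in> U} \<union> {x. \<bar>x\<bar> \<in> V}"
    using UV(2) unfolding abs_interval[symmetric] by blast
  have "partition_on {x. \<bar>x\<bar> \<in> V} ?Z"
    by (auto simp: partition_on_def disjoint_def)
  hence "partition_on ({- int m..int m} - {0}) (sym_lift f T \<union> ?Z)"
    unfolding eq using UV(1) by (intro partition_on_Un partition_on_sym_lift[OF P f]) auto
  moreover have "uminus ` B \<in> sym_lift f T \<union> ?Z" if "B \<in> sym_lift f T \<union> ?Z" for B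
    using that sym_lift_uminus[of B f T] zero_block_sym[of V] unfolding zero_block_def by auto
  moreover have "B \<in> ?Z" if "B \<in> sym_lift f T \<union> ?Z" "zero_block B" for B
    using sym_lift_not_zero[OF P f] that by blast
  hence "\<forall>B\<in>sym_lift f T \<union> ?Z. \<forall>C\<in>sym_lift f T \<union> ?Z. zero_block B \<and> zero_block C \<longrightarrow> B = C"
    by blast
  ultimately show ?thesis unfolding PiB_def by blast
qed

text \<open>Crossing of two chords is a symmetric relation between them.\<close>

lemma between_swap:
  assumes "a \<noteq> b" "a \<noteq> d" "c \<noteq> b" "c \<noteq> d" "between a c b = between a c d"
  shows "between b d a = between b d c"
  using assms unfolding between_def by (smt (verit))

lemma cpos_flip:
  "0 \<le> p \<Longrightarrow> 0 < x \<Longrightarrow> cpos m (flip p x) = (if x \<le> p then x else int m + x)"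
  "0 \<le> p \<Longrightarrow> 0 < x \<Longrightarrow> cpos m (- flip p x) = (if x \<le> p then int m + x else x)"
  by (auto simp: cpos_def flip_def)

text \<open>
  The diameter between \<open>p\<close> and its opposite cuts the circle into the two half circles
  \<open>flip p ` {1..m}\<close> and its negative, each of which is a rotated copy of \<open>1, \<dots>, m\<close>.
\<close>

lemma between_flip:
  assumes "0 \<le> p" "a \<in> {1..int m}" "b \<in> {1..int m}" "c \<in> {1..int m}" "d \<in> {1..int m}"
    "a \<noteq> b" "a \<noteq> d" "c \<noteq> b" "c \<noteq> d"
  shows "between (cpos m (flip p a)) (cpos m (flip p c)) (cpos m (flip p b)) =
         between (cpos m (flip p a)) (cpos m (flip p c)) (cpos m (flip p d)) \<longleftrightarrow>
         between a c b = between a c d"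
    and "between (cpos m (- flip p a)) (cpos m (- flip p c)) (cpos m (- flip p b)) =
         between (cpos m (- flip p a)) (cpos m (- flip p c)) (cpos m (- flip p d)) \<longleftrightarrow>
         between a c b = between a c d"
proof -
  have *: "0 < a" "0 < b" "0 < c" "0 < d" "a \<le> int m" "b \<le> int m" "c \<le> int m" "d \<le> int m"
    using assms by auto
  show "between (cpos m (flip p a)) (cpos m (flip p c)) (cpos m (flip p b)) =
         between (cpos m (flip p a)) (cpos m (flip p c)) (cpos m (flip p d)) \<longleftrightarrow>
         between a c b = between a c d"
    unfolding cpos_flip(1)[OF assms(1) *(1)] cpos_flip(1)[OF assms(1) *(2)]
      cpos_flip(1)[OF assms(1) *(3)] cpos_flip(1)[OF assms(1) *(4)] between_def
    using * assms(6-) by (smt (verit))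
  show "between (cpos m (- flip p a)) (cpos m (- flip p c)) (cpos m (- flip p b)) =
         between (cpos m (- flip p a)) (cpos m (- flip p c)) (cpos m (- flip p d)) \<longleftrightarrow>
         between a c b = between a c d"
    unfolding cpos_flip(2)[OF assms(1) *(1)] cpos_flip(2)[OF assms(1) *(2)]
      cpos_flip(2)[OF assms(1) *(3)] cpos_flip(2)[OF assms(1) *(4)] between_def
    using * assms(6-) by (smt (verit))
qed

text \<open>The half circles are complementary arcs, and a chord with both ends in one of them
  leaves the other entirely on one side.\<close>

lemma between_flip_opposite:
  assumes "0 \<le> p" "a \<in> {1..int m}" "b \<in> {1..int m}" "c \<in> {1..int m}" "d \<in> {1..int m}"
  shows "between (cpos m (flip p a)) (cpos m (flip p c)) (cpos m (- flip p b)) =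
         between (cpos m (flip p a)) (cpos m (flip p c)) (cpos m (- flip p d))"
    and "between (cpos m (- flip p a)) (cpos m (- flip p c)) (cpos m (flip p b)) =
         between (cpos m (- flip p a)) (cpos m (- flip p c)) (cpos m (flip p d))"
proof -
  have *: "0 < a" "0 < b" "0 < c" "0 < d" "a \<le> int m" "b \<le> int m" "c \<le> int m" "d \<le> int m"
    using assms by auto
  show "between (cpos m (flip p a)) (cpos m (flip p c)) (cpos m (- flip p b)) =
         between (cpos m (flip p a)) (cpos m (flip p c)) (cpos m (- flip p d))"
   "between (cpos m (- flip p a)) (cpos m (- flip p c)) (cpos m (flip p b)) =
         between (cpos m (- flip p a)) (cpos m (- flip p c)) (cpos m (flip p d))"
    unfolding cpos_flip[OF assms(1) *(1)] cpos_flip[OF assms(1) *(2)]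
      cpos_flip[OF assms(1) *(3)] cpos_flip[OF assms(1) *(4)] between_def
    using * by (smt (verit))+
qed

text \<open>Of a chord joining the two half circles only its end on the half circle of b and d
  matters, so c drops out. In the rotated order p+1, ..., m, 1, ..., p the element p is last, hence
  betweenness with respect to a and p decides the side.\<close>

lemma between_flip_across:
  assumes "0 \<le> p" "a \<in> {1..int m}" "b \<in> {1..int m}" "c \<in> {1..int m}" "d \<in> {1..int m}"
    "a \<noteq> b" "a \<noteq> d" "c \<noteq> b" "c \<noteq> d" "b \<noteq> p" "d \<noteq> p"
  shows "between (cpos m (flip p a)) (cpos m (- flip p c)) (cpos m (flip p b)) =
         between (cpos m (flip p a)) (cpos m (- flip p c)) (cpos m (flip p d)) \<longleftrightarrow>
         between a p b = between a p d"
    and "between (cpos m (- flip p a)) (cpos m (flip p c)) (cpos m (- flip p b)) =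
         between (cpos m (- flip p a)) (cpos m (flip p c)) (cpos m (- flip p d)) \<longleftrightarrow>
         between a p b = between a p d"
proof -
  have *: "0 < a" "0 < b" "0 < c" "0 < d" "a \<le> int m" "b \<le> int m" "c \<le> int m" "d \<le> int m"
    using assms by auto
  show "between (cpos m (flip p a)) (cpos m (- flip p c)) (cpos m (flip p b)) =
         between (cpos m (flip p a)) (cpos m (- flip p c)) (cpos m (flip p d)) \<longleftrightarrow>
         between a p b = between a p d"
   "between (cpos m (- flip p a)) (cpos m (flip p c)) (cpos m (- flip p b)) =
         between (cpos m (- flip p a)) (cpos m (flip p c)) (cpos m (- flip p d)) \<longleftrightarrow>
         between a p b = between a p d"
    unfolding cpos_flip[OF assms(1) *(1)] cpos_flip[OF assms(1) *(2)]
      cpos_flip[OF assms(1) *(3)] cpos_flip[OF assms(1) *(4)] between_def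
    using * assms(6-) by (smt (verit))+
qed

lemma between_commute: "between a c b = between c a b"
  by (auto simp: between_def)

lemma sym_merge_empty: "partition_on U \<sigma> \<Longrightarrow> sym_merge p \<sigma> {} = sym_lift (flip p) \<sigma>"
  by (auto simp: sym_merge_def partition_on_def)

lemma PiB_sym_merge:
  assumes P: "partition_on {1..int m} \<sigma>" and K: "K = {} \<or> K \<in> \<sigma>"
  shows "sym_merge p \<sigma> K \<in> PiB m"
  unfolding sym_merge_def
proof (rule PiB_sym_lift_union[OF partition_on_remove[OF P K]])
  show "section_on ({1..int m} - K) (flip p)" by (rule section_on_flip) auto
  show "({1..int m} - K) \<union> K = {1..int m}" using K partition_onD1[OF P] by blast
qed auto

text \<open>Lifts to the same half circle inherit noncrossing from \<sigma>, and lifts to opposite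
  ones lie in complementary arcs. The chords of the zero block that join the half circles are
  harmless because \<open>p \<in> K\<close>: the side of b is decided by the pair a, p, which lies
  inside the block K of \<sigma>.\<close>

lemma noncrossing_sym_merge:
  assumes P: "partition_on {1..int m} \<sigma>" and nc: "noncrossing (\<lambda>x. x) \<sigma>" and p: "0 \<le> p"
    and K: "K = {} \<or> K \<in> \<sigma> \<and> p \<in> K"
  shows "noncrossing (cpos m) (sym_merge p \<sigma> K)"
proof -
  have sub: "B \<subseteq> {1..int m}" if "B \<in> \<sigma>" for B
    using partition_onD1[OF P] that by blast
  have disj: "x \<noteq> y" if "B \<in> \<sigma>" "C \<in> \<sigma>" "B \<noteq> C" "x \<in> B" "y \<in> C" for B C x y
    using partition_on_eq[OF P that(1,2)] that by blast
  have nz: "between (cpos m (f a)) (cpos m (f c)) (cpos m (g b)) =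
       between (cpos m (f a)) (cpos m (f c)) (cpos m (g d))"
    if "B \<in> \<sigma>" "C \<in> \<sigma>" "f ` B \<noteq> g ` C" "a \<in> B" "c \<in> B" "b \<in> C" "d \<in> C"
      "f \<in> {flip p, \<lambda>x. - flip p x}" "g \<in> {flip p, \<lambda>x. - flip p x}" for B C f g a b c d
  proof -
    have ran: "a \<in> {1..int m}" "b \<in> {1..int m}" "c \<in> {1..int m}" "d \<in> {1..int m}"
      using that sub by blast+
    show ?thesis
    proof (cases "f = g")
      case True
      hence ne: "B \<noteq> C" using that by blast
      note d = disj[OF that(1,2) ne]
      have "between a c b = between a c d" using noncrossingD[OF nc that(1,2) ne that(4-7)] .
      thus ?thesis using between_flip[OF p ran] d that(4-8) True by blast
    next
      case False
      thus ?thesis using that(8,9) between_flip_opposite[OF p ran] by auto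
    qed
  qed
  have z: "between (cpos m a) (cpos m c) (cpos m (g b)) = between (cpos m a) (cpos m c) (cpos m (g d))"
    if "C \<in> \<sigma>" "C \<noteq> K" "\<bar>a\<bar> \<in> K" "\<bar>c\<bar> \<in> K" "b \<in> C" "d \<in> C"
      "g \<in> {flip p, \<lambda>x. - flip p x}" for C g a b c d
  proof -
    have K': "K \<in> \<sigma>" "p \<in> K" using K that by auto
    have ran: "\<bar>a\<bar> \<in> {1..int m}" "b \<in> {1..int m}" "\<bar>c\<bar> \<in> {1..int m}" "d \<in> {1..int m}"
      using that K' sub by blast+
    have flip_abs: "x = flip p \<bar>x\<bar> \<or> x = - flip p \<bar>x\<bar>" for x by (auto simp: flip_def)
    note dj = disj[OF K'(1) that(1) that(2)[symmetric]]
    have ne: "\<bar>a\<bar> \<noteq> b" "\<bar>a\<bar> \<noteq> d" "\<bar>c\<bar> \<noteq> b" "\<bar>c\<bar> \<noteq> d" "b \<noteq> p" "d \<noteq> p"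
      using dj that K' by blast+
    note N = noncrossingD[OF nc K'(1) that(1) that(2)[symmetric] _ _ that(5,6)]
    have nc1: "between \<bar>a\<bar> \<bar>c\<bar> b = between \<bar>a\<bar> \<bar>c\<bar> d" "between \<bar>a\<bar> p b = between \<bar>a\<bar> p d"
        "between \<bar>c\<bar> p b = between \<bar>c\<bar> p d"
      using N that K' by blast+
    obtain f where f: "f \<in> {flip p, \<lambda>x. - flip p x}" "a = f \<bar>a\<bar>" using flip_abs by blast
    obtain h where h: "h \<in> {flip p, \<lambda>x. - flip p x}" "c = h \<bar>c\<bar>" using flip_abs by blast
    have "between (cpos m (f \<bar>a\<bar>)) (cpos m (h \<bar>c\<bar>)) (cpos m (g b)) =
        between (cpos m (f \<bar>a\<bar>)) (cpos m (h \<bar>c\<bar>)) (cpos m (g d))"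
    proof (cases "f = h")
      case True
      show ?thesis
      proof (cases "f = g")
        case fg: True
        show ?thesis using between_flip[OF p ran ne(1-4)] nc1(1) f(1) True fg by blast
      next
        case False
        thus ?thesis using that(7) f(1) True between_flip_opposite[OF p ran] by auto
      qed
    next
      case False
      have ran2: "\<bar>c\<bar> \<in> {1..int m}" "b \<in> {1..int m}" "\<bar>a\<bar> \<in> {1..int m}" "d \<in> {1..int m}" using ran by auto
      note A1 = between_flip_across[OF p ran ne]
      \<comment> \<open>The roles of a and c are exchanged: the end that counts is the one on the
        half circle of \<open>g\<close>.\<close>
      note A2 = between_flip_across[OF p ran2 ne(3,4,1,2,5,6)]
      note B1 = A1(1)[THEN iffD2, OF nc1(2)] A1(2)[THEN iffD2, OF nc1(2)]
      note B2 = A2(1)[THEN iffD2, OF nc1(3)] A2(2)[THEN iffD2, OF nc1(3)]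
      consider "f = flip p" "h = (\<lambda>x. - flip p x)" | "f = (\<lambda>x. - flip p x)" "h = flip p"
        using f(1) h(1) False by blast
      thus ?thesis
      proof cases
        case 1
        show ?thesis
        proof (cases "g = flip p")
          case True
          thus ?thesis using B1(1) 1 by (simp only:)
        next
          case False
          hence "g = (\<lambda>x. - flip p x)" using that(7) by blast
          thus ?thesis using B2(2) 1 between_commute by (simp only:)
        qed
      next
        case 2
        show ?thesis
        proof (cases "g = flip p")
          case True
          thus ?thesis using B2(1) 2 between_commute by (simp only:)
        next
          case False
          hence "g = (\<lambda>x. - flip p x)" using that(7) by blast
          thus ?thesis using B1(2) 2 by (simp only:)
        qed
      qed
    qed
    thus ?thesis using f h by simp
  qed
  have K0: "K = {} \<or> K \<in> \<sigma>" using K by blast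
  have PiB: "sym_merge p \<sigma> K \<in> PiB m" by (rule PiB_sym_merge[OF P K0])
  hence PM: "partition_on ({- int m..int m} - {0}) (sym_merge p \<sigma> K)" by (simp add: PiB_def)
  have inj: "cpos m x \<noteq> cpos m y"
    if "E \<in> sym_merge p \<sigma> K" "E' \<in> sym_merge p \<sigma> K" "E \<noteq> E'" "x \<in> E" "y \<in> E'" for E E' x y
  proof -
    have "x \<in> {- int m..int m} - {0}" "y \<in> {- int m..int m} - {0}"
      using that partition_onD1[OF PM] by blast+
    moreover have "x \<noteq> y" using partition_on_eq[OF PM that(1,2)] that by blast
    ultimately show ?thesis by (auto simp: cpos_def split: if_splits)
  qed
  define Z where "Z = {x. \<bar>x\<bar> \<in> K}"
  have cs: "(\<exists>B\<in>\<sigma>. \<exists>g\<in>{flip p, \<lambda>x. - flip p x}. B \<noteq> K \<and> E = g ` B) \<or> E = Z"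
    if "E \<in> sym_merge p \<sigma> K" for E
  proof -
    have "uminus ` flip p ` B = (\<lambda>x. - flip p x) ` B" for B by (simp add: image_image)
    moreover have "(\<exists>B\<in>\<sigma> - {K}. E = flip p ` B \<or> E = uminus ` flip p ` B) \<or> E = Z"
      using that unfolding sym_merge_def sym_lift_def Z_def by auto
    ultimately show ?thesis by auto
  qed
  show ?thesis unfolding noncrossing_def
  proof (intro ballI impI)
    fix E E' a c b d
    assume *: "E \<in> sym_merge p \<sigma> K" "E' \<in> sym_merge p \<sigma> K" "E \<noteq> E'" "a \<in> E" "c \<in> E" "b \<in> E'" "d \<in> E'"
    show "between (cpos m a) (cpos m c) (cpos m b) = between (cpos m a) (cpos m c) (cpos m d)"
    proof (cases "E = Z")
      case True
      then obtain C g where C: "C\<in>\<sigma>" "g\<in>{flip p, \<lambda>x. - flip p x}" "C \<noteq> K" "E' = g ` C"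
        using cs[OF *(2)] *(3) by metis
      obtain b' d' where bd: "b' \<in> C" "d' \<in> C" "b = g b'" "d = g d'" using * C(4) by blast
      have "\<bar>a\<bar> \<in> K" "\<bar>c\<bar> \<in> K" using *(4,5) unfolding True Z_def by auto
      from z[OF C(1,3) this bd(1,2) C(2)] show ?thesis unfolding bd(3,4) .
    next
      case False
      then obtain B f where B: "B\<in>\<sigma>" "f\<in>{flip p, \<lambda>x. - flip p x}" "B \<noteq> K" "E = f ` B"
        using cs[OF *(1)] by metis
      show ?thesis
      proof (cases "E' = Z")
        case True
        \<comment> \<open>\<open>z\<close> only treats chords of the zero block; here the zero block
          is the other one, so the chords are swapped.\<close>
        have sw: "between (cpos m b) (cpos m d) (cpos m a) = between (cpos m b) (cpos m d) (cpos m c)"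
        proof -
          obtain a' c' where ac: "a' \<in> B" "c' \<in> B" "a = f a'" "c = f c'" using *(4,5) B(4) by blast
          have "\<bar>b\<bar> \<in> K" "\<bar>d\<bar> \<in> K" using *(6,7) unfolding True Z_def by auto
          from z[OF B(1,3) this ac(1,2) B(2)] show ?thesis unfolding ac(3,4) .
        qed
        show ?thesis
          by (rule between_swap[OF inj[OF *(1,2,3,4,6), symmetric] inj[OF *(1,2,3,5,6), symmetric]
            inj[OF *(1,2,3,4,7), symmetric] inj[OF *(1,2,3,5,7), symmetric] sw])
      next
        case False
        then obtain C g where C: "C\<in>\<sigma>" "g\<in>{flip p, \<lambda>x. - flip p x}" "C \<noteq> K" "E' = g ` C"
          using cs[OF *(2)] by metis
        have ne: "f ` B \<noteq> g ` C" using *(3) unfolding B(4) C(4) .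
        obtain a' c' where ac: "a' \<in> B" "c' \<in> B" "a = f a'" "c = f c'" using *(4,5) B(4) by blast
        obtain b' d' where bd: "b' \<in> C" "d' \<in> C" "b = g b'" "d = g d'" using *(6,7) C(4) by blast
        show ?thesis using nz[OF B(1) C(1) ne ac(1,2) bd(1,2) B(2) C(2)] unfolding ac(3,4) bd(3,4) .
      qed
    qed
  qed
qed

lemma NCB_sym_merge:
  assumes "\<sigma> \<in> NC m" "0 \<le> p" "K = {} \<or> K \<in> \<sigma> \<and> p \<in> K"
  shows "sym_merge p \<sigma> K \<in> NCB m"
proof -
  have P: "partition_on {1..int m} \<sigma>" "noncrossing (\<lambda>x. x) \<sigma>" using assms(1) unfolding NC_iff by auto
  have "K = {} \<or> K \<in> \<sigma>" using assms(3) by blast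
  thus ?thesis unfolding NCB_iff using PiB_sym_merge P noncrossing_sym_merge[OF P assms(2,3)] by blast
qed

text \<open>Each B in T contributes exactly one unordered pair of opposite nonzero blocks, of the
  size of B, and distinct B give distinct pairs. Zero blocks are not counted.\<close>

lemma typeB_sym_lift:
  assumes P: "partition_on U T" and U: "finite U" and f: "section_on U f"
    and Q: "\<forall>E\<in>Q. zero_block E" and fQ: "finite Q"
  shows "typeB (sym_lift f T \<union> Q) = type_of T"
proof (rule multiset_eqI)
  fix j
  have fT: "finite T" using P U by (metis finite_elements)
  let ?\<pi> = "sym_lift f T \<union> Q"
  have sub: "B \<subseteq> U" if "B \<in> T" for B using P that by (auto simp: partition_on_def)
  have card_f: "card (f ` B) = card B" "card (uminus ` f ` B) = card B" if "B \<in> T" for B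
    using section_inj[OF section_on_subset[OF f sub[OF that]]]
    by (auto simp: card_image image_image inj_on_def intro!: card_image)
  have fpi: "finite ?\<pi>" using fT fQ unfolding sym_lift_def by auto
  have eq: "card {{B, uminus ` B} | B. B \<in> ?\<pi> \<and> \<not> zero_block B \<and> card B = i} = card {B \<in> T. card B = i}"
    (is "card ?S = card ?R") for i
  proof -
    have "?S = (\<lambda>B. {f ` B, uminus ` f ` B}) ` ?R"
    proof (intro equalityI subsetI)
      fix X assume "X \<in> ?S"
      then obtain E where E: "X = {E, uminus ` E}" "E \<in> ?\<pi>" "\<not> zero_block E" "card E = i" by blast
      then obtain B where B: "B \<in> T" "E = f ` B \<or> E = uminus ` f ` B" using Q unfolding sym_lift_def by blast
      hence "X = {f ` B, uminus ` f ` B}" using E(1) uminus_image_twice by (metis insert_commute)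
      thus "X \<in> (\<lambda>B. {f ` B, uminus ` f ` B}) ` ?R" using B E(4) card_f by auto
    next
      fix X assume "X \<in> (\<lambda>B. {f ` B, uminus ` f ` B}) ` ?R"
      then obtain B where B: "B \<in> T" "card B = i" "X = {f ` B, uminus ` f ` B}" by blast
      have "f ` B \<in> sym_lift f T" using B unfolding sym_lift_def by blast
      thus "X \<in> ?S" using B card_f sym_lift_not_zero[OF P f] by blast
    qed
    moreover have "inj_on (\<lambda>B. {f ` B, uminus ` f ` B}) ?R"
    proof (rule inj_onI)
      fix B C assume *: "B \<in> ?R" "C \<in> ?R" "{f ` B, uminus ` f ` B} = {f ` C, uminus ` f ` C}"
      from *(3) have "f ` B = f ` C \<or> f ` B = uminus ` f ` C" unfolding doubleton_eq_iff by metis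
      moreover have "B \<subseteq> U" "C \<subseteq> U" using sub *(1,2) by auto
      ultimately show "B = C" using section_image_eq[OF f, of B C] by metis
    qed
    ultimately show ?thesis by (simp add: card_image)
  qed
  have "count (typeB ?\<pi>) j = (\<Sum>i\<in>card ` ?\<pi>. if i = j then card {B \<in> T. card B = i} else 0)"
    unfolding typeB_def eq count_sum by (intro sum.cong) auto
  also have "\<dots> = (if j \<in> card ` ?\<pi> then card {B \<in> T. card B = j} else 0)"
    using fpi by (simp add: sum.delta)
  also have "\<dots> = card {B \<in> T. card B = j}"
  proof -
    \<comment> \<open>The sum in \<open>typeB\<close> runs only over sizes that occur. A missing
      size j contributes 0, which is right because a block of T of that size would have a lift of
      that size.\<close>
    have "{B \<in> T. card B = j} = {}" if "j \<notin> card ` ?\<pi>"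
    proof -
      have "card B \<in> card ` ?\<pi>" if "B \<in> T" for B
      proof (rule image_eqI)
        show "card B = card (f ` B)" using card_f(1)[OF that] by simp
        show "f ` B \<in> ?\<pi>" using that unfolding sym_lift_def by blast
      qed
      thus ?thesis using that by blast
    qed
    thus ?thesis by (cases "j \<in> card ` ?\<pi>") (simp_all only: if_True if_False card.empty simp_thms)
  qed
  also have "\<dots> = count (type_of T) j"
    unfolding type_of_def count_image_mset using fT
    by (auto simp: vimage_def Int_def intro!: arg_cong[where f = card])
  finally show "count (typeB ?\<pi>) j = count (type_of T) j" .
qed

section \<open>Partitions of type D lifted from noncrossing partitions\<close>

lemma sym_lift_cong:
  assumes "\<And>B x. B \<in> T \<Longrightarrow> x \<in> B \<Longrightarrow> f x = g x"
  shows "sym_lift f T = sym_lift g T"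
proof -
  have "f ` B = g ` B" if "B \<in> T" for B using assms[OF that] by (intro image_cong refl)
  thus ?thesis unfolding sym_lift_def by (intro SUP_cong refl) metis
qed

lemma section_Un:
  assumes "section_on B f"
  shows "f ` B \<union> uminus ` f ` B = {x. \<bar>x\<bar> \<in> B}"
proof -
  have "x \<in> f ` B \<or> x \<in> uminus ` f ` B \<longleftrightarrow> \<bar>x\<bar> \<in> B" for x
  proof -
    have "\<bar>f \<bar>x\<bar>\<bar> = \<bar>x\<bar>" if "\<bar>x\<bar> \<in> B" using assms that by (simp add: section_on_def)
    thus ?thesis unfolding mem_section_image[OF assms] by (metis abs_eq_iff)
  qed
  thus ?thesis by blast
qed

lemma Un_Diff_empty: "{} \<notin> R \<Longrightarrow> R \<union> S - {{}} = R \<union> (S - {{}})"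
  by blast

text \<open>K is the block of \<sigma> that n and -n are attached to; \<open>K = {}\<close> means
  that they stay alone. The parameter p places the diameter, and a nonempty K must contain p for the
  chords of the merged block to be noncrossing.\<close>

locale lift_setup =
  fixes m :: nat and \<sigma> :: "int set set" and p :: int and K :: "int set"
  assumes NC: "\<sigma> \<in> NC m" and p0: "0 \<le> p" and K: "K = {} \<or> K \<in> \<sigma> \<and> p \<in> K"
begin

abbreviation "N \<equiv> int (Suc m)"

lemma part: "partition_on {1..int m} \<sigma>"
  and nonc: "noncrossing (\<lambda>x. x) \<sigma>"
  using NC by (auto simp: NC_iff)

lemma K0: "K = {} \<or> K \<in> \<sigma>" using K by blast

lemma block_subset: "B \<in> \<sigma> \<Longrightarrow> B \<subseteq> {1..int m}"
  using partition_onD1[OF part] by blast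

lemma K_subset: "K \<subseteq> {1..int m}"
  using K block_subset by blast

lemma finite_blocks: "finite \<sigma>"
  using part by (metis finite_elements finite_atLeastAtMost_int)

lemma part_rest: "partition_on ({1..int m} - K) (\<sigma> - {K})"
  by (rule partition_on_remove[OF part K0])

lemma part_insert: "partition_on (insert N {1..int m}) (insert (insert N K) (\<sigma> - {K}))"
proof -
  have "\<Union> (\<sigma> - {K}) = {1..int m} - K" using partition_onD1[OF part_rest] by simp
  hence "disjnt (insert N K) (\<Union> (\<sigma> - {K}))" by (auto simp: disjnt_def)
  moreover have "insert N {1..int m} - insert N K = {1..int m} - K" using K_subset by auto
  ultimately show ?thesis using part_rest K_subset by (subst partition_on_insert) auto
qed

lemma sec_rest: "section_on ({1..int m} - K) (flip p)"
  by (rule section_on_flip) auto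

lemma rest_abs:
  assumes "E \<in> sym_lift (flip p) (\<sigma> - {K})" "x \<in> E"
  shows "\<bar>x\<bar> \<in> {1..int m} - K"
proof -
  have "x \<in> {x. \<bar>x\<bar> \<in> {1..int m} - K}"
    unfolding partition_onD1[OF partition_on_sym_lift[OF part_rest sec_rest]] using assms by blast
  thus ?thesis by simp
qed

lemma rest_no_N: "E \<in> sym_lift (flip p) (\<sigma> - {K}) \<Longrightarrow> N \<notin> E \<and> - N \<notin> E"
  using rest_abs[of E N] rest_abs[of E "- N"] by auto

lemma rest_nonempty: "{} \<notin> sym_lift (flip p) (\<sigma> - {K})"
  by (rule partition_onD3[OF partition_on_sym_lift[OF part_rest sec_rest]])

lemma core_diff: "{x. \<bar>x\<bar> \<in> insert N K} - {N, - N} = {x. \<bar>x\<bar> \<in> K}"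
  using K_subset by (auto; linarith)

end

text \<open>The only freedom in f is the sign of its value at \<open>N\<close>, which decides which
  of the two lifts of K receives n.\<close>

locale lift_nonzero = lift_setup +
  fixes f :: "int \<Rightarrow> int"
  assumes f: "\<And>x. x \<in> {1..int m} \<Longrightarrow> f x = flip p x" and fN: "\<bar>f N\<bar> = N"
begin

abbreviation "\<pi> \<equiv> sym_lift f (insert (insert N K) (\<sigma> - {K}))"

lemma sec: "section_on (insert N {1..int m}) f"
  using f fN unfolding section_on_def by (auto simp: flip_def)

lemma sec_K: "section_on K f" "section_on (insert N K) f"
  by (rule section_on_subset[OF sec]; use K_subset in blast)+

lemma PiB: "\<pi> \<in> PiB (Suc m)"
proof -
  have "insert N {1..int m} = {1..int (Suc m)}" by auto
  thus ?thesis using PiB_sym_lift_union[OF part_insert sec, of "{}" "Suc m"] by simp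
qed

lemma not_zero: "E \<in> \<pi> \<Longrightarrow> \<not> zero_block E"
  by (rule sym_lift_not_zero[OF part_insert sec])

lemma pi_eq: "\<pi> = {f ` insert N K, uminus ` f ` insert N K} \<union> sym_lift (flip p) (\<sigma> - {K})"
proof -
  have "\<pi> = {f ` insert N K, uminus ` f ` insert N K} \<union> sym_lift f (\<sigma> - {K})"
    by (simp add: sym_lift_def)
  also have "sym_lift f (\<sigma> - {K}) = sym_lift (flip p) (\<sigma> - {K})"
    by (rule sym_lift_cong) (use block_subset f in blast)
  finally show ?thesis .
qed

lemma core: "N \<in> f ` insert N K \<or> - N \<in> f ` insert N K" "N \<in> uminus ` f ` insert N K \<or> - N \<in> uminus ` f ` insert N K"
proof -
  have 1: "\<bar>N\<bar> = N" "\<bar>- N\<bar> = N" by simp_all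
  have "f N = N \<or> f N = - N" using fN by linarith
  thus "N \<in> f ` insert N K \<or> - N \<in> f ` insert N K" "N \<in> uminus ` f ` insert N K \<or> - N \<in> uminus ` f ` insert N K"
    unfolding mem_section_image[OF sec_K(2)] 1 minus_minus by blast+
qed

lemma merge_eq: "merge_pm (Suc m) \<pi> = sym_merge p \<sigma> K"
proof -
  let ?R = "sym_lift (flip p) (\<sigma> - {K})"
  have sep: "{B \<in> {C, D} \<union> R. x \<notin> B \<and> y \<notin> B} = R \<and> {B \<in> {C, D} \<union> R. x \<in> B \<or> y \<in> B} = {C, D}"
    if "\<And>E. E \<in> R \<Longrightarrow> x \<notin> E \<and> y \<notin> E" "x \<in> C \<or> y \<in> C" "x \<in> D \<or> y \<in> D"
    for C D :: "int set" and R x y using that by blast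
  note sep = sep[OF rest_no_N core]
  have e1: "{B \<in> \<pi>. N \<notin> B \<and> - N \<notin> B} = ?R"
    unfolding pi_eq by (rule sep[THEN conjunct1])
  have e2: "{B \<in> \<pi>. N \<in> B \<or> - N \<in> B} = {f ` insert N K, uminus ` f ` insert N K}"
    unfolding pi_eq by (rule sep[THEN conjunct2])
  have e3: "\<Union> {f ` insert N K, uminus ` f ` insert N K} = {x. \<bar>x\<bar> \<in> insert N K}"
    using section_Un[OF sec_K(2)] by simp
  show ?thesis
    unfolding merge_pm_def sym_merge_def e1 e2 e3 core_diff by (rule Un_Diff_empty[OF rest_nonempty])
qed

lemma delete_eq: "delete_pm (Suc m) \<pi> = sym_lift (flip p) \<sigma>"
proof -
  let ?R = "sym_lift (flip p) (\<sigma> - {K})"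
  have img: "f ` K = flip p ` K" by (rule image_cong[OF refl]) (use K_subset f in blast)
  have "f N = N \<or> f N = - N" using fN by linarith
  moreover have nN: "N \<notin> flip p ` K" "- N \<notin> flip p ` K"
    using mem_section_image(1)[OF sec_K(1)] K_subset unfolding img by auto
  ultimately have fK: "f ` insert N K - {N, - N} = flip p ` K"
    unfolding image_insert img by blast
  have "uminus ` f ` insert N K - {N, - N} = uminus ` (f ` insert N K - {N, - N})"
    by (rule set_eqI) (simp only: mem_uminus_image Diff_iff insert_iff empty_iff neg_equal_iff_equal minus_equation_iff[of _ N], blast)
  hence fK': "uminus ` f ` insert N K - {N, - N} = uminus ` flip p ` K" unfolding fK .
  have "B - {N, - N} = B" if "B \<in> ?R" for B
    using rest_no_N[OF that] by auto
  hence "(\<lambda>B. B - {N, - N}) ` ?R = ?R" by (simp cong: image_cong)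
  hence "(\<lambda>B. B - {N, - N}) ` \<pi> = {flip p ` K, uminus ` flip p ` K} \<union> ?R"
    unfolding pi_eq image_Un image_insert[of "\<lambda>B. B - {N, - N}"] image_empty fK fK' by (simp only:)
  hence "delete_pm (Suc m) \<pi> = ?R \<union> {flip p ` K, uminus ` flip p ` K} - {{}}"
    unfolding delete_pm_def by (simp only: Un_commute)
  also have "\<dots> = ?R \<union> ({flip p ` K, uminus ` flip p ` K} - {{}})"
    by (rule Un_Diff_empty[OF rest_nonempty])
  also have "\<dots> = sym_lift (flip p) \<sigma>"
  proof (cases "K = {}")
    case True
    hence "\<sigma> - {K} = \<sigma>" using part by (auto simp: partition_on_def)
    thus ?thesis using True by simp
  next
    case False
    have "sym_lift (flip p) (insert K (\<sigma> - {K})) = {flip p ` K, uminus ` flip p ` K} \<union> ?R"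
      unfolding sym_lift_def by (rule UN_insert)
    moreover have "insert K (\<sigma> - {K}) = \<sigma>" using K0 False by blast
    ultimately have "sym_lift (flip p) \<sigma> = {flip p ` K, uminus ` flip p ` K} \<union> ?R" by (simp only:)
    thus ?thesis using False by auto
  qed
  finally show ?thesis .
qed

text \<open>Merging turns K into a zero block, while deleting keeps its two lifts apart like those
  of any other block. So the two conditions are \<open>NCB_sym_merge\<close> for K and for the empty
  core.\<close>

lemma NCD: "\<pi> \<in> NCD (Suc m)"
proof -
  have "merge_pm (Suc m) \<pi> \<in> NCB m" unfolding merge_eq by (rule NCB_sym_merge[OF NC p0 K])
  moreover have "delete_pm (Suc m) \<pi> \<in> NCB m"
    unfolding delete_eq using NCB_sym_merge[OF NC p0, of "{}"] sym_merge_empty[OF part] by simp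
  ultimately show ?thesis unfolding NCD_def using PiB not_zero by simp
qed

lemma type_eq: "typeB \<pi> = type_of (\<sigma> - {K}) + {#card K + 1#}"
proof -
  have fin: "finite (insert N {1..int m})" by simp
  have K1: "insert N K \<notin> \<sigma> - {K}" "N \<notin> K" using block_subset[of "insert N K"] K_subset by auto
  have fK: "finite K" using K_subset finite_subset by blast
  have "typeB \<pi> = type_of (insert (insert N K) (\<sigma> - {K}))"
    using typeB_sym_lift[OF part_insert fin sec, of "{}"] by simp
  also have "\<dots> = add_mset (card (insert N K)) (type_of (\<sigma> - {K}))"
    unfolding type_of_def using K1 finite_blocks by (subst mset_set.insert) auto
  finally show ?thesis using fK K1 by simp
qed

end

locale lift_zero = lift_setup +
  assumes K_block: "K \<in> \<sigma>"
begin

abbreviation "\<pi> \<equiv> sym_lift (flip p) (\<sigma> - {K}) \<union> {{x. \<bar>x\<bar> \<in> insert N K}}"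

lemma PiB: "\<pi> \<in> PiB (Suc m)"
proof -
  have "({1..int m} - K) \<union> insert N K = {1..int (Suc m)}" using K_subset by auto
  moreover have "({1..int m} - K) \<inter> insert N K = {}" by auto
  moreover have "{{x. \<bar>x\<bar> \<in> insert N K}} - {{}} = {{x. \<bar>x\<bar> \<in> insert N K}}"
  proof -
    have "N \<in> {x. \<bar>x\<bar> \<in> insert N K}" by simp
    thus ?thesis by blast
  qed
  ultimately show ?thesis using PiB_sym_lift_union[OF part_rest sec_rest, of "insert N K" "Suc m"] by (simp only:)
qed

lemma merge_eq: "merge_pm (Suc m) \<pi> = sym_merge p \<sigma> K"
proof -
  have e1: "{B \<in> \<pi>. N \<notin> B \<and> - N \<notin> B} = sym_lift (flip p) (\<sigma> - {K})"
    using rest_no_N by auto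
  have e2: "\<Union> {B \<in> \<pi>. N \<in> B \<or> - N \<in> B} = {x. \<bar>x\<bar> \<in> insert N K}"
  proof -
    have "{B \<in> \<pi>. N \<in> B \<or> - N \<in> B} = {{x. \<bar>x\<bar> \<in> insert N K}}"
      using rest_no_N by auto
    thus ?thesis by simp
  qed
  show ?thesis
    unfolding merge_pm_def sym_merge_def e1 e2 core_diff by (rule Un_Diff_empty[OF rest_nonempty])
qed

lemma delete_eq: "delete_pm (Suc m) \<pi> = sym_merge p \<sigma> K"
proof -
  have "B - {N, - N} = B" if "B \<in> sym_lift (flip p) (\<sigma> - {K})" for B
    using rest_no_N[OF that] by auto
  hence "(\<lambda>B. B - {N, - N}) ` sym_lift (flip p) (\<sigma> - {K}) = sym_lift (flip p) (\<sigma> - {K})"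
    by (simp cong: image_cong)
  thus ?thesis unfolding delete_pm_def sym_merge_def image_Un image_insert image_empty core_diff
    by (simp only: Un_Diff_empty[OF rest_nonempty])
qed

lemma K_nonempty: "K \<noteq> {}"
  using K_block part by (auto simp: partition_on_def)

lemma zero_iff: "E \<in> \<pi> \<Longrightarrow> zero_block E \<longleftrightarrow> E = {x. \<bar>x\<bar> \<in> insert N K}"
  using sym_lift_not_zero[OF part_rest sec_rest, of E] zero_block_sym[of "insert N K"] by auto

lemma NCD: "\<pi> \<in> NCD (Suc m)"
proof -
  have "sym_merge p \<sigma> K \<in> NCB m" by (rule NCB_sym_merge[OF NC p0 K])
  moreover have "{N, - N} \<subset> {x. \<bar>x\<bar> \<in> insert N K}"
  proof -
    obtain k where "k \<in> K" using K_nonempty by blast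
    hence "k \<in> {x. \<bar>x\<bar> \<in> insert N K}" "k \<notin> {N, - N}" using K_subset by auto
    moreover have "{N, - N} \<subseteq> {x. \<bar>x\<bar> \<in> insert N K}" by auto
    ultimately show ?thesis by blast
  qed
  ultimately show ?thesis unfolding NCD_def using PiB zero_iff merge_eq delete_eq by auto
qed

lemma type_eq: "typeB \<pi> = type_of (\<sigma> - {K})"
  by (rule typeB_sym_lift[OF part_rest _ sec_rest]) (use zero_block_sym[of "insert N K"] in auto)

end

section \<open>Computation of the map on a lift\<close>

text \<open>Two such lists have the same strictly sorted list of maxima, and \<open>Max\<close> is
  injective on X, so the lists agree.\<close>

lemma blocks_by_max_eqI:
  assumes "set As = X" "sorted_wrt (\<lambda>A B. Max A < Max B) As"
  shows "blocks_by_max X = As"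
  unfolding blocks_by_max_def
proof (rule the_equality)
  show "set As = X \<and> sorted_wrt (\<lambda>A B. Max A < Max B) As" using assms by blast
  fix Bs assume Bs: "set Bs = X \<and> sorted_wrt (\<lambda>A B. Max A < Max B) Bs"
  have s: "sorted_wrt (<) (map Max As)" "sorted_wrt (<) (map Max Bs)"
    using assms Bs by (simp_all add: sorted_wrt_map)
  have "map Max As = map Max Bs"
    using s assms(1) Bs by (intro sorted_distinct_set_unique) (auto simp: strict_sorted_iff)
  moreover have "inj_on Max (set As \<union> set Bs)"
    using s(1) assms(1) Bs by (simp add: strict_sorted_iff distinct_map)
  ultimately show "Bs = As" by (metis map_inj_on)
qed

lemma sorted_by_key_exists:
  fixes key :: "'a \<Rightarrow> int"
  assumes "finite S" "inj_on key S"
  shows "\<exists>xs. set xs = S \<and> sorted_wrt (\<lambda>x y. key x < key y) xs"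
proof (intro exI conjI)
  let ?l = "sorted_list_of_set (key ` S)" and ?g = "inv_into S key"
  have sl: "set ?l = key ` S" using assms by simp
  show "set (map ?g ?l) = S" using sl assms(2) by (simp add: inv_into_image_cancel)
  have "sorted_wrt (<) ?l" by simp
  thus "sorted_wrt (\<lambda>x y. key x < key y) (map ?g ?l)"
    unfolding sorted_wrt_map by (rule sorted_wrt_mono_rel[rotated]) (use sl in \<open>auto simp: f_inv_into_f\<close>)
qed

section \<open>Cutting a noncrossing partition at p\<close>

context lift_setup
begin

text \<open>\<open>low B\<close> and \<open>upp B\<close> turn out to be the positive parts of the
  two lifts of B.\<close>

definition low :: "int set \<Rightarrow> int set" where "low B = B \<inter> {..p}"
definition upp :: "int set \<Rightarrow> int set" where "upp B = B \<inter> {p<..}"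
definition cut :: "int set set" where "cut = (\<Union>B\<in>\<sigma>. {low B, upp B}) - {{}}"
definition split :: "int set set" where "split = {B \<in> \<sigma>. low B \<noteq> {} \<and> upp B \<noteq> {}}"
text \<open>With \<open>cut\<close>, this is the pair that the first map returns on a lift. The
  parts of K are included even if K is not split, since they share a block with n, -n or negative
  integers; an empty K adds nothing.\<close>

definition marked :: "int set set" where "marked = (\<Union>B\<in>insert K split. {low B, upp B}) - {{}}"

lemma low_upp: "low B \<union> upp B = B" "low B \<subseteq> B" "upp B \<subseteq> B"
  by (auto simp: low_def upp_def)

lemma mem_low: "x \<in> low B \<longleftrightarrow> x \<in> B \<and> x \<le> p" and mem_upp: "x \<in> upp B \<longleftrightarrow> x \<in> B \<and> p < x"
  by (auto simp: low_def upp_def)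

lemma finite_block: "B \<in> \<sigma> \<Longrightarrow> finite B"
  using block_subset finite_subset by blast

lemma finite_parts: "B \<in> \<sigma> \<Longrightarrow> finite (low B)" "B \<in> \<sigma> \<Longrightarrow> finite (upp B)"
  using finite_block by (auto simp: low_def upp_def)

lemma block_eq: "B \<in> \<sigma> \<Longrightarrow> C \<in> \<sigma> \<Longrightarrow> x \<in> B \<Longrightarrow> x \<in> C \<Longrightarrow> B = C"
  using partition_on_eq[OF part] .

lemma positive_parts:
  assumes "B \<subseteq> {1..int m}"
  shows "flip p ` B \<inter> {0<..} = low B" "uminus ` flip p ` B \<inter> {0<..} = upp B"
proof -
  have s: "section_on B (flip p)" using assms by (intro section_on_flip) auto
  have B: "0 < x" if "x \<in> B" for x using assms that by auto
  show "flip p ` B \<inter> {0<..} = low B"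
  proof (rule set_eqI)
    fix x show "x \<in> flip p ` B \<inter> {0<..} \<longleftrightarrow> x \<in> low B"
      using B[of x] p0 unfolding Int_iff mem_section_image(1)[OF s] mem_low
      by (cases "0 < x") (auto simp: flip_def)
  qed
  show "uminus ` flip p ` B \<inter> {0<..} = upp B"
  proof (rule set_eqI)
    fix x show "x \<in> uminus ` flip p ` B \<inter> {0<..} \<longleftrightarrow> x \<in> upp B"
      using B[of x] p0 unfolding Int_iff mem_section_image(2)[OF s] mem_upp
      by (cases "0 < x") (auto simp: flip_def)
  qed
qed

text \<open>The computation shared by \<open>phiB_NC\<close> and \<open>phiD_NC\<close>: g takes
  positive parts, with or without removing n, and C collects the blocks over the core. Both lifts of
  a split block contain negative integers, so its parts are proper subsets. A block that is neither
  split nor K lifts to itself and its negative, so its positive part is a whole block.\<close>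

lemma cut_marked:
  assumes g: "\<And>B. g B = B \<inter> {0<..} \<or> g B = B \<inter> {0<..} - {N}"
    and C1: "g ` C - {{}} = {low K, upp K} - {{}}"
    and C2: "\<And>A. A \<in> {low K, upp K} \<Longrightarrow> A \<noteq> {} \<Longrightarrow> \<exists>E\<in>C. A \<subset> E"
    and C3: "\<And>E x. E \<in> C \<Longrightarrow> x \<in> E \<Longrightarrow> \<bar>x\<bar> \<in> insert N K"
  shows "g ` (sym_lift (flip p) (\<sigma> - {K}) \<union> C) - {{}} = cut"
    and "{A \<in> cut. \<exists>E\<in>sym_lift (flip p) (\<sigma> - {K}) \<union> C. A \<subset> E} = marked"
proof -
  have g': "g (flip p ` B) = low B" "g (uminus ` flip p ` B) = upp B" if "B \<in> \<sigma>" for B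
  proof -
    have "N \<notin> low B" "N \<notin> upp B" using block_subset[OF that] by (auto simp: low_def upp_def)
    thus "g (flip p ` B) = low B" "g (uminus ` flip p ` B) = upp B"
      using positive_parts[OF block_subset[OF that]] g[of "flip p ` B"] g[of "uminus ` flip p ` B"] by auto
  qed
  have "g ` sym_lift (flip p) (\<sigma> - {K}) = (\<Union>B\<in>\<sigma> - {K}. {low B, upp B})"
  proof -
    have "g ` sym_lift (flip p) (\<sigma> - {K}) = (\<Union>B\<in>\<sigma> - {K}. {g (flip p ` B), g (uminus ` flip p ` B)})"
      unfolding sym_lift_def by blast
    also have "\<dots> = (\<Union>B\<in>\<sigma> - {K}. {low B, upp B})"
      by (rule SUP_cong) (use g' in simp_all)
    finally show ?thesis .
  qed
  hence "g ` (sym_lift (flip p) (\<sigma> - {K}) \<union> C) - {{}} =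
      ((\<Union>B\<in>\<sigma> - {K}. {low B, upp B}) - {{}}) \<union> ({low K, upp K} - {{}})"
    unfolding image_Un Un_Diff C1 by (simp only:)
  also have "\<dots> = cut"
  proof (cases "K = {}")
    case True
    hence "low K = {}" "upp K = {}" by (simp_all add: low_def upp_def)
    thus ?thesis using True part unfolding cut_def by (auto simp: partition_on_def)
  next
    case False
    hence "\<sigma> = insert K (\<sigma> - {K})" using K0 by blast
    hence "cut = (\<Union>B\<in>insert K (\<sigma> - {K}). {low B, upp B}) - {{}}" unfolding cut_def by simp
    thus ?thesis by (simp only: UN_insert Un_Diff Un_commute)
  qed
  finally show "g ` (sym_lift (flip p) (\<sigma> - {K}) \<union> C) - {{}} = cut" .
  show "{A \<in> cut. \<exists>E\<in>sym_lift (flip p) (\<sigma> - {K}) \<union> C. A \<subset> E} = marked"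
  proof (intro equalityI subsetI)
    fix A assume "A \<in> {A \<in> cut. \<exists>E\<in>sym_lift (flip p) (\<sigma> - {K}) \<union> C. A \<subset> E}"
    then obtain E where A: "A \<in> cut" "E \<in> sym_lift (flip p) (\<sigma> - {K}) \<union> C" "A \<subset> E" by blast
    obtain B where B: "B \<in> \<sigma>" "A = low B \<or> A = upp B" "A \<noteq> {}" using A(1) unfolding cut_def by blast
    show "A \<in> marked"
    proof (cases "B = K \<or> B \<in> split")
      case True
      thus ?thesis using B unfolding marked_def by blast
    next
      case False
      obtain x where x: "x \<in> A" using B by blast
      hence xB: "x \<in> B" "0 < x" "x \<noteq> N" using B low_upp block_subset[OF B(1)] by force+
      have "E \<notin> C"
      proof
        assume "E \<in> C"
        hence "x \<in> insert N K" using C3[of E x] A x xB by auto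
        hence "x \<in> K" using xB by blast
        thus False using block_eq[OF B(1) _ xB(1)] K0 False by blast
      qed
      then obtain D where D: "D \<in> \<sigma>" "E = flip p ` D \<or> E = uminus ` flip p ` D"
        using A(2) unfolding sym_lift_def by blast
      have "section_on D (flip p)" using block_subset[OF D(1)] by (intro section_on_flip) auto
      from mem_section_image[OF this, of x] have "x \<in> D" using D(2) A(3) x xB by auto
      hence DB: "D = B" using block_eq[OF D(1) B(1)] xB by blast
      have "A = B" using False B low_upp[of B] unfolding split_def by auto
      have "low B = {} \<or> upp B = {}" using False B(1) unfolding split_def by blast
      \<comment> \<open>An unsplit block lies on one side of p, where \<open>flip p\<close> is the
        identity or negation; x picks the positive copy.\<close>
      hence "A = E"
      proof
        assume l: "low B = {}"
        hence AU: "A = upp B" using B by blast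
        have gt: "p < y" if "y \<in> B" for y using l that by (auto simp: low_def)
        have "flip p y = - y" if "y \<in> B" for y using gt[OF that] by (simp add: flip_def)
        hence "flip p ` B = uminus ` B" by (intro image_cong) auto
        hence "E = uminus ` B \<or> E = B" using D(2) DB by (metis uminus_image_twice)
        moreover have "x \<notin> uminus ` B" using block_subset[OF B(1)] xB by (auto simp: mem_uminus_image)
        ultimately show ?thesis using A(3) x \<open>A = B\<close> by blast
      next
        assume u: "upp B = {}"
        have le: "y \<le> p" if "y \<in> B" for y using u that by (auto simp: upp_def)
        have "flip p y = y" if "y \<in> B" for y using le[OF that] by (simp add: flip_def)
        hence "flip p ` B = B" by auto
        hence "E = B \<or> E = uminus ` B" using D(2) DB by metis
        moreover have "x \<notin> uminus ` B" using block_subset[OF B(1)] xB by (auto simp: mem_uminus_image)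
        ultimately show ?thesis using A(3) x \<open>A = B\<close> by blast
      qed
      thus ?thesis using A(3) by blast
    qed
  next
    fix A assume "A \<in> marked"
    then obtain B where B: "B = K \<or> B \<in> split" "A = low B \<or> A = upp B" "A \<noteq> {}" unfolding marked_def by blast
    have Bs: "B \<in> \<sigma>" using B K0 low_upp unfolding split_def by (cases "B = K") auto
    have Ac: "A \<in> cut" using Bs B unfolding cut_def by blast
    moreover have "\<exists>E\<in>sym_lift (flip p) (\<sigma> - {K}) \<union> C. A \<subset> E"
    proof (cases "B = K")
      case True
      thus ?thesis using C2[of A] B by blast
    next
      case False
      hence sp: "low B \<noteq> {}" "upp B \<noteq> {}" using B unfolding split_def by blast+
      have in1: "flip p ` B \<in> sym_lift (flip p) (\<sigma> - {K})" "uminus ` flip p ` B \<in> sym_lift (flip p) (\<sigma> - {K})"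
        using False Bs unfolding sym_lift_def by blast+
      have pos: "flip p ` B \<inter> {0<..} = low B" "uminus ` flip p ` B \<inter> {0<..} = upp B"
        using positive_parts[OF block_subset[OF Bs]] by auto
      obtain u where u: "u \<in> B" "p < u" using sp by (auto simp: upp_def)
      obtain l where l: "l \<in> B" "l \<le> p" using sp by (auto simp: low_def)
      have "- u \<in> flip p ` B" using u by (auto simp: flip_def image_iff)
      moreover have "- l \<in> uminus ` flip p ` B" using l by (auto simp: flip_def image_iff mem_uminus_image)
      moreover have "- u \<notin> low B" "- l \<notin> upp B" using block_subset[OF Bs] u l by (auto simp: low_def upp_def)
      ultimately have "low B \<subset> flip p ` B" "upp B \<subset> uminus ` flip p ` B" using pos by blast+
      thus ?thesis using in1 B by blast
    qed
    ultimately show "A \<in> {A \<in> cut. \<exists>E\<in>sym_lift (flip p) (\<sigma> - {K}) \<union> C. A \<subset> E}" by blast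
  qed
qed

end

section \<open>The value of the first map on a lift\<close>

context lift_setup
begin

lemma empty_notin: "{} \<notin> \<sigma>"
  using part by (simp add: partition_on_def)

lemma low_upp_empty: "low {} = {}" "upp {} = {}"
  by (simp_all add: low_def upp_def)

text \<open>The positive part of the zero block is all of K, which agrees with \<open>cut\<close>
  only if K is not cut. The assumption covers both an empty K and the choice of p as the maximum of
  K.\<close>

lemma phi_merge:
  assumes "upp K = {}"
  shows "phiB_NC (sym_merge p \<sigma> K) = (cut, marked)"
proof -
  let ?C = "{{x. \<bar>x\<bar> \<in> K}} - {{}}" and ?g = "\<lambda>B :: int set. B \<inter> {0<..}"
  have pos: "{x. \<bar>x\<bar> \<in> K} \<inter> {0<..} = K" using K_subset by auto
  have lK: "low K = K" using low_upp(1)[of K] assms by simp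
  have ne: "?C = {{x. \<bar>x\<bar> \<in> K}}" if KN: "K \<noteq> {}"
  proof -
    obtain k where "k \<in> K" using KN by blast
    hence "k \<in> {x. \<bar>x\<bar> \<in> K}" using K_subset by auto
    thus ?thesis by blast
  qed
  have C1: "?g ` ?C - {{}} = {low K, upp K} - {{}}"
  proof (cases "K = {}")
    case False
    thus ?thesis using pos unfolding ne[OF False] assms lK by auto
  qed (simp add: low_upp_empty)
  have C2: "\<exists>E\<in>?C. A \<subset> E" if "A \<in> {low K, upp K}" "A \<noteq> {}" for A
  proof -
    have A: "A = K" "K \<noteq> {}" using that assms lK by auto
    obtain k where k: "k \<in> K" using A by blast
    have pos: "0 < x" if "x \<in> K" for x using K_subset that by auto
    have "- k \<in> {x. \<bar>x\<bar> \<in> K}" "- k \<notin> K" using k pos[of k] pos[of "- k"] by auto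
    moreover have "K \<subseteq> {x. \<bar>x\<bar> \<in> K}" using K_subset by auto
    ultimately have "K \<subset> {x. \<bar>x\<bar> \<in> K}" by blast
    thus ?thesis unfolding ne[OF A(2)] A(1) by blast
  qed
  have C3: "\<bar>x\<bar> \<in> insert N K" if "E \<in> ?C" "x \<in> E" for E x using that by auto
  have g: "?g B = B \<inter> {0<..} \<or> ?g B = B \<inter> {0<..} - {N}" for B by simp
  have cm1: "?g ` sym_merge p \<sigma> K - {{}} = cut"
    unfolding sym_merge_def by (rule cut_marked(1)[of ?g ?C, OF g C1 C2 C3])
  have cm2: "{A \<in> cut. \<exists>B\<in>sym_merge p \<sigma> K. A \<subset> B} = marked"
    unfolding sym_merge_def by (rule cut_marked(2)[of ?g ?C, OF g C1 C2 C3])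
  show ?thesis unfolding phiB_NC_def Let_def cm1 cm2 ..
qed

lemma split_subset: "split \<subseteq> \<sigma>"
  by (auto simp: split_def)

lemma K_split_iff: "K \<noteq> {} \<Longrightarrow> K \<in> split \<longleftrightarrow> upp K \<noteq> {}"
  using K by (auto simp: split_def low_def)

lemma cut_cases:
  assumes "A \<in> cut"
  obtains B where "B \<in> \<sigma>" "A = low B \<or> A = upp B" "A \<noteq> {}" "A \<subseteq> B"
  using assms low_upp unfolding cut_def by blast

text \<open>Parts of different blocks inherit noncrossing, and the two parts of one block are
  separated by p.\<close>

lemma cut_NC: "cut \<in> NC m"
proof -
  have "partition_on {1..int m} cut"
  proof (rule partition_onI)
    have "\<Union> cut = (\<Union>B\<in>\<sigma>. low B \<union> upp B)" unfolding cut_def by auto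
    thus "\<Union> cut = {1..int m}" using partition_onD1[OF part] by (simp add: low_upp)
    show "{} \<notin> cut" unfolding cut_def by blast
    show "disjnt A A'" if A: "A \<in> cut" "A' \<in> cut" "A \<noteq> A'" for A A'
    proof (rule ccontr)
      assume "\<not> disjnt A A'"
      then obtain x where x: "x \<in> A" "x \<in> A'" by (auto simp: disjnt_def)
      obtain B where B: "B \<in> \<sigma>" "A = low B \<or> A = upp B" "A \<subseteq> B" using cut_cases[OF A(1)] by blast
      obtain B' where B': "B' \<in> \<sigma>" "A' = low B' \<or> A' = upp B'" "A' \<subseteq> B'" using cut_cases[OF A(2)] by blast
      have "B = B'" using block_eq[OF B(1) B'(1)] x B(3) B'(3) by blast
      thus False using B(2) B'(2) x A(3) mem_low[of x] mem_upp[of x] by force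
    qed
  qed
  moreover have "noncrossing (\<lambda>x. x) cut" unfolding noncrossing_def
  proof (intro ballI impI)
    fix A A' a c b d
    assume *: "A \<in> cut" "A' \<in> cut" "A \<noteq> A'" "a \<in> A" "c \<in> A" "b \<in> A'" "d \<in> A'"
    obtain B where B: "B \<in> \<sigma>" "A = low B \<or> A = upp B" "A \<subseteq> B" using cut_cases[OF *(1)] by blast
    obtain B' where B': "B' \<in> \<sigma>" "A' = low B' \<or> A' = upp B'" "A' \<subseteq> B'" using cut_cases[OF *(2)] by blast
    show "between a c b = between a c d"
    proof (cases "B = B'")
      case True
      hence "(A = low B \<and> A' = upp B) \<or> (A = upp B \<and> A' = low B)" using B(2) B'(2) *(3) by blast
      thus ?thesis using *(4-7) unfolding between_def low_def upp_def by auto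
    next
      case False
      have "a \<in> B" "c \<in> B" "b \<in> B'" "d \<in> B'" using * B(3) B'(3) by blast+
      from noncrossingD[OF nonc B(1) B'(1) False this] show ?thesis .
    qed
  qed
  ultimately show ?thesis unfolding NC_iff by blast
qed

lemma marked_cases:
  assumes "A \<in> marked"
  obtains B where "B \<in> split" "A = low B" | B where "B \<in> split" "A = upp B"
    | "K \<noteq> {}" "upp K = {}" "A = K" "Max K = p"
proof -
  have "A \<noteq> {}" using assms unfolding marked_def by blast
  consider B where "B \<in> split" "A = low B \<or> A = upp B" | "A = low K \<or> A = upp K" "K \<noteq> {}" "K \<notin> split"
    using assms low_upp_empty unfolding marked_def by blast
  thus thesis
  proof cases
    case 1
    thus thesis using that(1,2) by blast
  next
    case 2
    hence uK: "upp K = {}" using K_split_iff by blast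
    hence lK: "low K = K" using low_upp(1)[of K] by simp
    have "A = K" using 2 uK lK \<open>A \<noteq> {}\<close> by blast
    moreover have "Max K = p"
    proof (rule Max_eqI)
      show "finite K" using finite_block K0 by blast
      show "p \<in> K" using K 2 by blast
      show "y \<le> p" if "y \<in> K" for y using that lK mem_low by blast
    qed
    ultimately show thesis using that(3) 2(2) uK by blast
  qed
qed

lemma cut_edge:
  assumes "(i, j) \<in> edges cut"
  obtains B where "B \<in> \<sigma>" "i \<in> B" "j \<in> B" "i < j" "j \<le> p \<or> p < i"
proof -
  obtain A where A: "A \<in> cut" "i \<in> A" "j \<in> A" "i < j" using assms unfolding edges_def by blast
  obtain B where B: "B \<in> \<sigma>" "A = low B \<or> A = upp B" "A \<subseteq> B" using cut_cases[OF A(1)] by blast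
  have "j \<le> p \<or> p < i" using A B(2) mem_low mem_upp by blast
  thus thesis using that[OF B(1)] A B(3) by blast
qed

text \<open>No edge of \<open>cut\<close> passes over p. An edge above one part of a split block B
  would therefore separate that part from the other one, so its block would cross B. Above an
  unsplit core there is no edge since its maximum is p.\<close>

lemma marked_nonnested: "A \<in> marked \<Longrightarrow> nonnested cut A"
  unfolding nonnested_def
proof
  assume A: "A \<in> marked" and "\<exists>i j. (i, j) \<in> edges cut \<and> i < Min A \<and> Min A \<le> Max A \<and> Max A < j"
  then obtain i j where ij: "(i, j) \<in> edges cut" "i < Min A" "Min A \<le> Max A" "Max A < j" by blast
  obtain D where D: "D \<in> \<sigma>" "i \<in> D" "j \<in> D" "i < j" "j \<le> p \<or> p < i" using cut_edge[OF ij(1)] by blast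
  from A show False
  proof (cases rule: marked_cases)
    case (1 B)
    hence B: "B \<in> \<sigma>" "low B \<noteq> {}" "upp B \<noteq> {}" by (auto simp: split_def)
    note fin = finite_parts[OF B(1)]
    have M: "Max (low B) \<in> B" "Max (low B) \<le> p" "Min (low B) \<le> p"
      using Max_in[OF fin(1) B(2)] Min_in[OF fin(1) B(2)] mem_low by blast+
    obtain u where u: "u \<in> B" "p < u" using B(3) mem_upp by blast
    have jp: "j \<le> p" using D(5) ij(2) 1(2) M(3) by auto
    have "B \<noteq> D"
    proof
      assume "B = D"
      hence "j \<in> low B" using D(3) jp mem_low by blast
      hence "j \<le> Max (low B)" using fin(1) by simp
      thus False using ij(4) 1(2) by simp
    qed
    from noncrossingD[OF nonc D(1) B(1) this[symmetric] D(2,3) M(1) u(1)]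
    show False using ij 1(2) jp u(2) D(4) unfolding between_def by auto
  next
    case (2 B)
    hence B: "B \<in> \<sigma>" "low B \<noteq> {}" "upp B \<noteq> {}" by (auto simp: split_def)
    note fin = finite_parts[OF B(1)]
    have M: "Min (upp B) \<in> B" "p < Min (upp B)" "p < Max (upp B)"
      using Min_in[OF fin(2) B(3)] Max_in[OF fin(2) B(3)] mem_upp by blast+
    obtain l where l: "l \<in> B" "l \<le> p" using B(2) mem_low by blast
    have ip: "p < i" using D(5) ij(4) 2(2) M(3) by auto
    have "B \<noteq> D"
    proof
      assume "B = D"
      hence "i \<in> upp B" using D(2) ip mem_upp by blast
      hence "Min (upp B) \<le> i" using fin(2) by simp
      thus False using ij(2) 2(2) by simp
    qed
    from noncrossingD[OF nonc D(1) B(1) this[symmetric] D(2,3) M(1) l(1)]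
    show False using ij 2(2) ip l(2) D(4) unfolding between_def by auto
  next
    case 3
    have "finite K" using finite_block K0 by blast
    hence "Min K \<le> Max K" using 3(1) Min_le Max_in by blast
    thus False using D(5) ij 3(3,4) by auto
  qed
qed

lemma marked_NCNN:
  assumes "\<epsilon> \<in> {-1, 0, 1}" "marked = {} \<Longrightarrow> \<epsilon> = 0"
  shows "(cut, marked, \<epsilon>) \<in> NCNN m"
proof -
  have "marked \<subseteq> cut"
  proof
    fix A assume "A \<in> marked"
    then obtain B where "B = K \<or> B \<in> split" "A = low B \<or> A = upp B" "A \<noteq> {}" unfolding marked_def by blast
    moreover from this have "B \<in> \<sigma>" using K0 split_subset low_upp_empty by blast
    ultimately show "A \<in> cut" unfolding cut_def by blast
  qed
  thus ?thesis unfolding NCNN_def using cut_NC marked_nonnested assms by blast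
qed

end

context lift_nonzero
begin

lemma fN_cases: "f N = N \<or> f N = - N"
  using fN by linarith

lemma mem_core:
  "0 < a \<Longrightarrow> a < N \<Longrightarrow> a \<in> f ` insert N K \<longleftrightarrow> a \<in> low K"
  "0 < a \<Longrightarrow> a < N \<Longrightarrow> - a \<in> f ` insert N K \<longleftrightarrow> a \<in> upp K"
  "0 < a \<Longrightarrow> a < N \<Longrightarrow> a \<in> uminus ` f ` insert N K \<longleftrightarrow> a \<in> upp K"
  "0 < a \<Longrightarrow> a < N \<Longrightarrow> - a \<in> uminus ` f ` insert N K \<longleftrightarrow> a \<in> low K"
  using f[of a] unfolding mem_section_image[OF sec_K(2)] mem_low mem_upp
  by (auto simp: flip_def split: if_splits)

lemma phi_eq_singleton:
  assumes "K = {}"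
  shows "phiD_NC (Suc m) \<pi> = (cut, marked, 0)"
proof -
  have "{N} \<in> \<pi>" "{- N} \<in> \<pi>"
    unfolding pi_eq using fN_cases assms by auto
  moreover have "phiB_NC (merge_pm (Suc m) \<pi>) = (cut, marked)"
    unfolding merge_eq by (rule phi_merge) (simp add: assms low_upp_empty)
  ultimately show ?thesis unfolding phiD_NC_def by simp
qed

text \<open>The image of K under \<open>flip p\<close> has positive part \<open>low K\<close>,
  nonempty because p is in K, and the negatives of \<open>upp K\<close> as negative part. Since the
  maximum of \<open>low K\<close> is at most p and that of \<open>upp K\<close> exceeds p, the test
  defining \<epsilon> yields 1 exactly if n sits with this image.\<close>

lemma phi_eq:
  assumes "K \<noteq> {}"
  shows "phiD_NC (Suc m) \<pi> = (cut, marked, if f N = N then 1 else -1)"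
proof -
  let ?F = "f ` insert N K" and ?G = "uminus ` f ` insert N K"
  have low_pos: "0 < a \<and> a < N" if "a \<in> low K \<or> a \<in> upp K" for a
    using that K_subset mem_low mem_upp by force
  obtain k where k: "k \<in> K" using assms by blast
  have fk: "f k \<in> ?F" "- f k \<in> ?G" "\<bar>f k\<bar> = k" "k < N" "0 < k"
    using k sec_K(1) K_subset unfolding section_on_def by auto
  define g where "g = (\<lambda>B :: int set. B \<inter> {0<..} - {N})"
  have gF: "g ?F = low K"
  proof (rule set_eqI)
    fix x show "x \<in> g ?F \<longleftrightarrow> x \<in> low K"
    proof (cases "0 < x \<and> x < N")
      case True
      thus ?thesis using mem_core(1)[of x] by (auto simp: g_def simp del: image_insert)
    next
      case False
      thus ?thesis using low_pos[of x] mem_section_image(1)[OF sec_K(2), of x] K_subset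
        by (auto simp: g_def simp del: image_insert)
    qed
  qed
  have gG: "g ?G = upp K"
  proof (rule set_eqI)
    fix x show "x \<in> g ?G \<longleftrightarrow> x \<in> upp K"
    proof (cases "0 < x \<and> x < N")
      case True
      thus ?thesis using mem_core(3)[of x] by (auto simp: g_def simp del: image_insert)
    next
      case False
      thus ?thesis using low_pos[of x] mem_section_image(2)[OF sec_K(2), of x] K_subset
        by (auto simp: g_def simp del: image_insert)
    qed
  qed
  have C1: "g ` {?F, ?G} - {{}} = {low K, upp K} - {{}}"
    by (simp only: image_insert[of g] image_empty gF gG)
  have C2: "\<exists>E\<in>{?F, ?G}. A \<subset> E" if "A \<in> {low K, upp K}" "A \<noteq> {}" for A
  proof -
    have "low K \<subseteq> ?F" "upp K \<subseteq> ?G" using gF gG unfolding g_def by blast+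
    moreover have "N \<notin> low K" "- N \<notin> low K" "N \<notin> upp K" "- N \<notin> upp K" using low_pos by force+
    ultimately have "low K \<subset> ?F" "upp K \<subset> ?G" using core by blast+
    thus ?thesis using that by blast
  qed
  have C3: "\<bar>x\<bar> \<in> insert N K" if "E \<in> {?F, ?G}" "x \<in> E" for E x
    using that mem_section_image[OF sec_K(2), of x] by blast
  have pi: "\<pi> = sym_lift (flip p) (\<sigma> - {K}) \<union> {?F, ?G}" unfolding pi_eq by (rule Un_commute)
  have g: "g B = B \<inter> {0<..} \<or> g B = B \<inter> {0<..} - {N}" for B by (simp add: g_def)
  have cm1: "(\<lambda>B. B \<inter> {0<..} - {N}) ` \<pi> - {{}} = cut"
    using cut_marked(1)[of g "{?F, ?G}", OF g C1 C2 C3] unfolding g_def pi .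
  have cm2: "{A \<in> cut. \<exists>B\<in>\<pi>. A \<subset> B} = marked"
    using cut_marked(2)[of g "{?F, ?G}", OF g C1 C2 C3] unfolding pi .
  have no1: "\<not> ({N} \<in> \<pi> \<and> {- N} \<in> \<pi>)"
  proof
    assume "{N} \<in> \<pi> \<and> {- N} \<in> \<pi>"
    hence "{N} \<in> {?F, ?G}" unfolding pi_eq using rest_no_N[of "{N}"] by blast
    hence "{N} = ?F \<or> {N} = ?G" by blast
    hence "f k = N \<or> - f k = N" using fk(1,2) by blast
    thus False using fk by auto
  qed
  define S where "S = (if f N = N then ?F else ?G)"
  have S: "S \<in> \<pi>" "N \<in> S"
    unfolding S_def pi_eq using fN_cases mem_section_image[OF sec_K(2), of N]
    by (auto simp del: image_insert)
  have the: "(THE B. B \<in> \<pi> \<and> N \<in> B) = S"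
  proof (rule the_equality)
    show "S \<in> \<pi> \<and> N \<in> S" using S by blast
    show "B = S" if "B \<in> \<pi> \<and> N \<in> B" for B
      using partition_on_eq[OF _ _ S(1) _ S(2)] that PiB unfolding PiB_def by blast
  qed
  define as where "as = {a \<in> S. 0 < a \<and> a < N}"
  define bs where "bs = {b. 0 < b \<and> b < N \<and> - b \<in> S}"
  have memS: "a \<in> S \<longleftrightarrow> a \<in> (if f N = N then low K else upp K)"
     "- a \<in> S \<longleftrightarrow> a \<in> (if f N = N then upp K else low K)" if "0 < a" "a < N" for a
    using mem_core[OF that] unfolding S_def by metis+
  have as_eq: "as = (if f N = N then low K else upp K)"
    by (rule set_eqI) (metis (mono_tags, lifting) as_def mem_Collect_eq memS(1) low_pos)
  have bs_eq: "bs = (if f N = N then upp K else low K)"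
    by (rule set_eqI) (metis (mono_tags, lifting) bs_def mem_Collect_eq memS(2) low_pos)
  have ab: "as = low K \<and> bs = upp K" if "f N = N"
    unfolding as_eq bs_eq if_P[OF that] by blast
  have ba: "as = upp K \<and> bs = low K" if "f N \<noteq> N"
    unfolding as_eq bs_eq if_not_P[OF that] by blast
  have lK: "low K \<noteq> {}" using K assms mem_low by blast
  have fin: "finite (low K)" "finite (upp K)" using finite_parts K0 assms by blast+
  have lt: "Max (low K) < Max (upp K)" if "upp K \<noteq> {}"
    using Max_in[OF fin(1) lK] Max_in[OF fin(2) that] mem_low mem_upp by force
  have eps: "(if bs = {} \<or> (as \<noteq> {} \<and> bs \<noteq> {} \<and> Max as < Max bs) then 1 else -1 :: int) = (if f N = N then 1 else -1)"
  proof (cases "f N = N")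
    case True
    thus ?thesis using ab[OF True] lt lK by auto
  next
    case False
    hence "\<not> (as \<noteq> {} \<and> Max as < Max bs)" using ba lt by force
    thus ?thesis using ba[OF False] lK False by auto
  qed
  have c: "\<not> (({N} \<in> \<pi> \<and> {- N} \<in> \<pi>) \<or> (\<exists>B\<in>\<pi>. zero_block B))" using no1 not_zero by blast
  show ?thesis
    unfolding phiD_NC_def if_not_P[OF c] Let_def the as_def[symmetric] bs_def[symmetric] eps
      cm1 cm2 ..
qed

end

context lift_zero
begin

lemma phi_eq:
  assumes "upp K = {}"
  shows "phiD_NC (Suc m) \<pi> = (cut, marked, 0)"
proof -
  have "{x. \<bar>x\<bar> \<in> insert N K} \<in> \<pi>" by blast
  moreover have "zero_block {x. \<bar>x\<bar> \<in> insert N K}" by (rule zero_block_sym)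
  ultimately have "\<exists>B\<in>\<pi>. zero_block B" by blast
  thus ?thesis unfolding phiD_NC_def merge_eq phi_merge[OF assms] by simp
qed

end

section \<open>The order of the marked blocks and the value of the second map\<close>

context lift_setup
begin

lemma split_parts:
  assumes "B \<in> split"
  shows "B \<in> \<sigma>" "Max (low B) \<in> B" "Max (low B) \<le> p" "Max (upp B) \<in> B" "p < Max (upp B)"
    "Min (upp B) \<in> B" "p < Min (upp B)" "finite (low B)" "finite (upp B)"
proof -
  have B: "B \<in> \<sigma>" "low B \<noteq> {}" "upp B \<noteq> {}" using assms by (auto simp: split_def)
  note fin = finite_parts[OF B(1)]
  show "B \<in> \<sigma>" "finite (low B)" "finite (upp B)" using B(1) fin by auto
  show "Max (low B) \<in> B" "Max (low B) \<le> p" using Max_in[OF fin(1) B(2)] mem_low by blast+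
  show "Max (upp B) \<in> B" "p < Max (upp B)" using Max_in[OF fin(2) B(3)] mem_upp by blast+
  show "Min (upp B) \<in> B" "p < Min (upp B)" using Min_in[OF fin(2) B(3)] mem_upp by blast+
qed

text \<open>The split blocks all straddle \<open>p\<close>, so being noncrossing they are nested.\<close>

lemma split_nested:
  assumes B: "B \<in> split" and C: "C \<in> split" and lt: "Max (low B) < Max (low C)"
  shows "Max (upp C) < Max (upp B)"
proof -
  note b = split_parts[OF B] and c = split_parts[OF C]
  have ne: "B \<noteq> C" using lt by blast
  have d: "Max (upp C) \<noteq> Max (upp B)" using block_eq[OF b(1) c(1) b(4)] c(4) ne by metis
  from noncrossingD[OF nonc b(1) c(1) ne b(2,4) c(2,4)]
  show ?thesis using lt b(3,5) c(3,5) d unfolding between_def by linarith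
qed

lemma inj_Max_low: "inj_on (\<lambda>B. Max (low B)) split"
proof (rule inj_onI)
  fix B C assume *: "B \<in> split" "C \<in> split" "Max (low B) = Max (low C)"
  note b = split_parts[OF *(1)] and c = split_parts[OF *(2)]
  show "B = C" by (rule block_eq[OF b(1) c(1) b(2)]) (use c(2) *(3) in simp)
qed

lemma finite_split: "finite split"
  using finite_blocks split_subset finite_subset by blast

text \<open>An unsplit core is the one marked block without a partner. Its maximum is p, which
  places it between all lower and all upper parts; a split core is already listed through
  \<open>split\<close>.\<close>

definition middle :: "int set list" where
  "middle = (if K = {} \<or> K \<in> split then [] else [K])"

lemma middle_cases:
  obtains "middle = []" "K = {} \<or> K \<in> split"
  | "middle = [K]" "K \<noteq> {}" "K \<notin> split" "upp K = {}" "low K = K" "Max K = p"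
proof (cases "K = {} \<or> K \<in> split")
  case True
  thus thesis using that(1) by (simp add: middle_def)
next
  case False
  hence u: "upp K = {}" using K_split_iff by blast
  have l: "low K = K" using low_upp(1)[of K] u by simp
  have "Max K = p"
  proof (rule Max_eqI)
    show "finite K" using finite_block K0 False by blast
    show "p \<in> K" using K False by blast
    show "y \<le> p" if "y \<in> K" for y using that l mem_low by blast
  qed
  thus thesis using that(2) False u l by (simp add: middle_def)
qed

context
  fixes Bs :: "int set list"
  assumes set_Bs: "set Bs = split"
    and sorted_Bs: "sorted_wrt (\<lambda>B C. Max (low B) < Max (low C)) Bs"
begin

text \<open>By nestedness the upper parts are ordered oppositely to the lower ones, so entries at
  equal distance from the two ends belong to the same block.\<close>

abbreviation "As \<equiv> map low Bs @ middle @ map upp (rev Bs)"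

lemma set_As: "set As = marked"
proof -
  have *: "low B \<noteq> {}" "upp B \<noteq> {}" if "B \<in> split" for B using that by (auto simp: split_def)
  have "marked = ({low K, upp K} - {{}}) \<union> low ` split \<union> upp ` split"
    unfolding marked_def using * by auto
  also have "\<dots> = set middle \<union> low ` split \<union> upp ` split"
  proof (cases rule: middle_cases)
    case 1
    thus ?thesis using low_upp_empty by auto
  qed auto
  finally show ?thesis using set_Bs by auto
qed

lemma sorted_As: "sorted_wrt (\<lambda>A B. Max A < Max B) As"
proof -
  have 1: "sorted_wrt (\<lambda>A B. Max A < Max B) (map low Bs)"
    using sorted_Bs by (simp add: sorted_wrt_map)
  have 2: "sorted_wrt (\<lambda>A B. Max A < Max B) (map upp (rev Bs))"
    unfolding sorted_wrt_map sorted_wrt_rev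
    by (rule sorted_wrt_mono_rel[OF _ sorted_Bs]) (use split_nested set_Bs in blast)
  have 3: "Max (low B) < Max (upp C)" if "B \<in> split" "C \<in> split" for B C
    using split_parts[OF that(1)] split_parts[OF that(2)] by linarith
  show ?thesis
  proof (cases rule: middle_cases)
    case 1
    thus ?thesis using \<open>sorted_wrt _ (map low Bs)\<close> 2 3 set_Bs by (auto simp: sorted_wrt_append)
  next
    case M: 2
    have pK: "p \<in> K" "K \<in> \<sigma>" using K M by auto
    \<comment> \<open>The inequality is strict because p already belongs to K, which is not
      split.\<close>
    have "Max (low B) < p" if "B \<in> split" for B
    proof -
      note b = split_parts[OF that]
      have "Max (low B) \<noteq> p" using block_eq[OF b(1) pK(2) b(2)] pK(1) M(3) that by metis
      thus ?thesis using b(3) by linarith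
    qed
    thus ?thesis using 1 2 3 M set_Bs split_parts(5) by (auto simp: sorted_wrt_append)
  qed
qed

lemma blocks_marked: "blocks_by_max marked = As"
  by (rule blocks_by_max_eqI[OF set_As sorted_As])

lemma card_marked: "card marked = 2 * length Bs + length middle"
proof -
  have "sorted_wrt (<) (map Max As)" using sorted_As by (simp only: sorted_wrt_map)
  hence "distinct As" by (simp only: strict_sorted_iff distinct_map)
  thus ?thesis using distinct_card[of As] unfolding set_As by simp
qed

text \<open>The indices keep the shape they have in \<open>varphiD\<close>, which counts from 1
  while list positions count from 0.\<close>

lemma nth_As:
  assumes "i \<in> {1..length Bs}"
  shows "As ! (i - 1) = low (Bs ! (i - 1))"
    and "As ! (card marked + 1 - i - 1) = upp (Bs ! (i - 1))"
proof -
  show "As ! (i - 1) = low (Bs ! (i - 1))" using assms by (auto simp: nth_append)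
  have "card marked + 1 - i - 1 = length Bs + length middle + (length Bs - i)"
    using assms unfolding card_marked by auto
  moreover have "(map low Bs @ middle @ ys) ! (length Bs + length middle + j) = ys ! j" for ys j
    by (simp add: nth_append)
  ultimately have "As ! (card marked + 1 - i - 1) = map upp (rev Bs) ! (length Bs - i)" by simp
  also have "\<dots> = upp (Bs ! (i - 1))"
    using assms by (auto simp: rev_nth)
  finally show "As ! (card marked + 1 - i - 1) = upp (Bs ! (i - 1))" .
qed

text \<open>The partition produced by \<open>varphiD\<close> once the pairs are identified: split
  blocks are rejoined, and every other block survives in \<open>cut\<close> unchanged.\<close>

lemma merged_eq:
  "(cut - (\<Union>B\<in>split. {low B, upp B})) \<union> split = \<sigma>"
proof (intro equalityI subsetI)
  fix A assume "A \<in> (cut - (\<Union>B\<in>split. {low B, upp B})) \<union> split"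
  thus "A \<in> \<sigma>"
  proof
    assume A: "A \<in> cut - (\<Union>B\<in>split. {low B, upp B})"
    hence A1: "A \<in> cut" and A2: "\<And>B. B \<in> split \<Longrightarrow> A \<noteq> low B \<and> A \<noteq> upp B" by auto
    obtain B where B: "B \<in> \<sigma>" "A = low B \<or> A = upp B" "A \<noteq> {}" using A1 by (rule cut_cases)
    hence "B \<notin> split" using A2[of B] by blast
    hence "low B = {} \<or> upp B = {}" using B(1) unfolding split_def by blast
    hence "A = B" using B(2,3) low_upp(1)[of B] by auto
    thus ?thesis using B by simp
  qed (use split_subset in blast)
next
  fix B assume B: "B \<in> \<sigma>"
  show "B \<in> (cut - (\<Union>B\<in>split. {low B, upp B})) \<union> split"
  proof (cases "B \<in> split")
    case False
    have "B \<noteq> {}" using B empty_notin by blast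
    have "low B = {} \<or> upp B = {}" using False B unfolding split_def by blast
    hence "B = low B \<or> B = upp B" using low_upp(1)[of B] by auto
    hence "B \<in> cut" using B \<open>B \<noteq> {}\<close> unfolding cut_def by blast
    moreover have "B \<noteq> low C \<and> B \<noteq> upp C" if "C \<in> split" for C
    proof (rule ccontr)
      assume "\<not> ?thesis"
      hence "B \<subseteq> C" using low_upp[of C] by blast
      moreover have "C \<in> \<sigma>" using split_subset that by blast
      moreover obtain x where "x \<in> B" using \<open>B \<noteq> {}\<close> by blast
      ultimately have "B = C" using block_eq[OF B, of C x] by blast
      thus False using False that by blast
    qed
    ultimately show ?thesis by blast
  qed blast
qed

lemma length_middle: "length middle \<le> 1"
  by (simp add: middle_def)

lemma varphi_raw:
  assumes "\<epsilon> \<in> {-1, 0, 1}" "marked = {} \<Longrightarrow> \<epsilon> = 0"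
  shows "varphiD (Suc m) (cut, marked, \<epsilon>) = (\<sigma>,
    if \<epsilon> = 0 then
      if card marked = 0 then MEmpty
      else if even (card marked) then MEdge (Max (As ! (length Bs - 1)), Min (As ! length Bs))
      else MBlock (As ! length Bs)
    else MInt (\<epsilon> * Max (As ! ((card marked + 1) div 2 - 1))))"
proof -
  let ?k = "card marked"
  \<comment> \<open>The possible middle entry is lost in the division, so exactly the split blocks
    are paired.\<close>
  have half: "?k div 2 = length Bs" unfolding card_marked using length_middle by auto
  have im: "(\<lambda>i. Bs ! (i - 1)) ` {1..length Bs} = split"
  proof -
    have "(\<lambda>i. Bs ! (i - 1)) ` {1..length Bs} = (\<lambda>i. Bs ! i) ` {0..<length Bs}"
    proof -
      have "{1..length Bs} = Suc ` {0..<length Bs}"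
        by (simp add: image_Suc_atLeastLessThan atLeastLessThanSuc_atLeastAtMost)
      thus ?thesis by (simp only: image_image diff_Suc_1)
    qed
    also have "\<dots> = set Bs" by (simp add: nth_image[of "length Bs" Bs, simplified])
    finally show ?thesis using set_Bs by simp
  qed
  have u1: "(\<Union>i\<in>{1..length Bs}. {As ! (i - 1), As ! (?k + 1 - i - 1)}) = (\<Union>B\<in>split. {low B, upp B})"
  proof -
    have "(\<Union>i\<in>{1..length Bs}. {As ! (i - 1), As ! (?k + 1 - i - 1)}) =
        (\<Union>i\<in>{1..length Bs}. {low (Bs ! (i - 1)), upp (Bs ! (i - 1))})"
      by (rule SUP_cong[OF refl]) (simp only: nth_As)
    also have "\<dots> = (\<Union>B\<in>(\<lambda>i. Bs ! (i - 1)) ` {1..length Bs}. {low B, upp B})" by simp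
    finally show ?thesis unfolding im .
  qed
  have u2: "(\<lambda>i. As ! (i - 1) \<union> As ! (?k + 1 - i - 1)) ` {1..length Bs} = split"
  proof -
    have "(\<lambda>i. As ! (i - 1) \<union> As ! (?k + 1 - i - 1)) ` {1..length Bs} = (\<lambda>i. Bs ! (i - 1)) ` {1..length Bs}"
      by (rule image_cong[OF refl]) (simp only: nth_As low_upp)
    thus ?thesis unfolding im .
  qed
  have dom: "(cut, marked, \<epsilon>) \<in> NCNN (Suc m - 1)" using marked_NCNN[OF assms] by simp
  show ?thesis
    unfolding varphiD_def restrict_apply if_P[OF dom] prod.case Let_def blocks_marked half u1 u2 merged_eq
    by simp
qed

text \<open>The lower part of a split block containing p has the largest maximum possible, namely p,
  so this block is the innermost one and comes last.\<close>

lemma last_Bs_core: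
  assumes "B \<in> split" "p \<in> B"
  shows "Bs \<noteq> []" "Bs ! (length Bs - 1) = B" "Max (low B) = p"
proof -
  have Mp: "Max (low B) = p"
  proof (rule Max_eqI)
    show "finite (low B)" using split_parts(8)[OF assms(1)] .
  qed (use assms mem_low in auto)
  show "Max (low B) = p" by fact
  show ne: "Bs \<noteq> []" using assms(1) set_Bs by auto
  obtain j where j: "j < length Bs" "Bs ! j = B" using assms(1) set_Bs by (metis in_set_conv_nth)
  have "j = length Bs - 1"
  proof (rule ccontr)
    assume "j \<noteq> length Bs - 1"
    hence "j < length Bs - 1" "length Bs - 1 < length Bs" using j by auto
    hence "Max (low (Bs ! j)) < Max (low (Bs ! (length Bs - 1)))"
      using sorted_Bs by (simp add: sorted_wrt_iff_nth_less)
    moreover have "Bs ! (length Bs - 1) \<in> split" using set_Bs ne by (metis last_conv_nth last_in_set)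
    ultimately show False using split_parts(3) j(2) Mp by fastforce
  qed
  thus "Bs ! (length Bs - 1) = B" using j by simp
qed

lemma nth_As_middle: "middle = [K] \<Longrightarrow> As ! length Bs = K"
  by (simp add: nth_append)

lemma nth_As_edge: "middle = [] \<Longrightarrow> Bs \<noteq> [] \<Longrightarrow> As ! length Bs = upp (Bs ! (length Bs - 1))"
  by (simp add: nth_append rev_nth)

lemma nth_As_low: "Bs \<noteq> [] \<Longrightarrow> As ! (length Bs - 1) = low (Bs ! (length Bs - 1))"
  by (simp add: nth_append)

lemma varphi_int0:
  assumes "K \<noteq> {}" "\<epsilon> \<in> {-1, 1}"
  shows "varphiD (Suc m) (cut, marked, \<epsilon>) = (\<sigma>, MInt (\<epsilon> * p))"
proof -
  have lK: "low K \<noteq> {}" using K assms(1) mem_low by blast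
  hence "low K \<in> marked" unfolding marked_def by blast
  hence ne: "marked \<noteq> {}" by blast
  \<comment> \<open>The index hits \<open>low K\<close>, the last lower part, if K is split, and the
    middle entry K otherwise. Both have maximum p.\<close>
  have "Max (As ! ((card marked + 1) div 2 - 1)) = p"
  proof (cases rule: middle_cases)
    case 1
    hence Ks: "K \<in> split" "p \<in> K" using assms(1) K by auto
    note l = last_Bs_core[OF Ks]
    have "(card marked + 1) div 2 - 1 = length Bs - 1" unfolding card_marked 1 by simp
    thus ?thesis using nth_As_low[OF l(1)] l by simp
  next
    case 2
    have "(card marked + 1) div 2 - 1 = length Bs" unfolding card_marked 2 by simp
    thus ?thesis using nth_As_middle[OF 2(1)] 2(6) by simp
  qed
  thus ?thesis using varphi_raw[of \<epsilon>] ne assms(2) by auto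
qed

lemma varphi_empty0:
  assumes "K = {}" "split = {}"
  shows "varphiD (Suc m) (cut, marked, 0) = (\<sigma>, MEmpty)"
proof -
  have i: "insert K split = {{}}" using assms by simp
  have "marked = {}" unfolding marked_def i by (simp add: low_upp_empty)
  thus ?thesis using varphi_raw[of 0] by simp
qed

text \<open>The block of the edge is the innermost split block; its lower part ends at p and its
  upper part begins at the successor b.\<close>

lemma varphi_edge0:
  assumes "K = {}" and e: "(p, b) \<in> edges \<sigma>"
  shows "varphiD (Suc m) (cut, marked, 0) = (\<sigma>, MEdge (p, b))"
proof -
  obtain B where B: "B \<in> \<sigma>" "p \<in> B" "b \<in> B" "p < b" "\<not> (\<exists>k\<in>B. p < k \<and> k < b)"
    using e unfolding edges_def by blast
  have "p \<in> low B" "b \<in> upp B" using B mem_low mem_upp by auto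
  hence Bs: "B \<in> split" using B(1) unfolding split_def by blast
  note l = last_Bs_core[OF Bs B(2)]
  have M: "middle = []" unfolding middle_def using assms(1) by simp
  have "Min (upp B) = b"
  proof (rule Min_eqI)
    show "finite (upp B)" using split_parts(9)[OF Bs] .
    show "b \<le> y" if "y \<in> upp B" for y using B(5) that mem_upp by force
  qed fact
  moreover have "card marked \<noteq> 0" "even (card marked)" unfolding card_marked M using l(1) by auto
  ultimately show ?thesis
    using varphi_raw[of 0] nth_As_low[OF l(1)] nth_As_edge[OF M l(1)] l by simp
qed

lemma varphi_block0:
  assumes "K \<noteq> {}" "upp K = {}"
  shows "varphiD (Suc m) (cut, marked, 0) = (\<sigma>, MBlock K)"
proof -
  have M: "middle = [K]" using assms K_split_iff by (simp add: middle_def)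
  have "card marked \<noteq> 0" "odd (card marked)" unfolding card_marked M by auto
  thus ?thesis using varphi_raw[of 0] nth_As_middle[OF M] by simp
qed

end

lemma sorted_split_exists:
  "\<exists>Bs. set Bs = split \<and> sorted_wrt (\<lambda>B C. Max (low B) < Max (low C)) Bs"
  by (rule sorted_by_key_exists[OF finite_split inj_Max_low])

lemma varphi_int:
  "K \<noteq> {} \<Longrightarrow> \<epsilon> \<in> {-1, 1} \<Longrightarrow> varphiD (Suc m) (cut, marked, \<epsilon>) = (\<sigma>, MInt (\<epsilon> * p))"
  using sorted_split_exists varphi_int0 by blast

lemma varphi_empty:
  "K = {} \<Longrightarrow> split = {} \<Longrightarrow> varphiD (Suc m) (cut, marked, 0) = (\<sigma>, MEmpty)"
  using sorted_split_exists varphi_empty0 by blast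

lemma varphi_edge:
  "K = {} \<Longrightarrow> (p, b) \<in> edges \<sigma> \<Longrightarrow> varphiD (Suc m) (cut, marked, 0) = (\<sigma>, MEdge (p, b))"
  using sorted_split_exists varphi_edge0 by blast

lemma varphi_block:
  "K \<noteq> {} \<Longrightarrow> upp K = {} \<Longrightarrow> varphiD (Suc m) (cut, marked, 0) = (\<sigma>, MBlock K)"
  using sorted_split_exists varphi_block0 by blast

end

section \<open>Every noncrossing partition of type D is a lift\<close>

text \<open>B lies in one of the two half circles of the diameter at p. Testing the sign of each
  element makes the notion independent of m.\<close>

definition onesided :: "int \<Rightarrow> int set \<Rightarrow> bool" where
  "onesided p B \<longleftrightarrow> (\<forall>x\<in>B. flip p \<bar>x\<bar> = x) \<or> (\<forall>x\<in>B. flip p \<bar>x\<bar> = - x)"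

lemma onesided_uminus: "onesided p (uminus ` B) \<longleftrightarrow> onesided p B"
  unfolding onesided_def by auto

lemma onesided_image:
  assumes "onesided p B"
  shows "flip p ` abs ` B = B \<or> flip p ` abs ` B = uminus ` B"
  using assms unfolding onesided_def
proof
  assume "\<forall>x\<in>B. flip p \<bar>x\<bar> = x"
  hence "(\<lambda>x. flip p \<bar>x\<bar>) ` B = (\<lambda>x. x) ` B" by (intro image_cong) auto
  thus ?thesis by (simp add: image_image)
next
  assume "\<forall>x\<in>B. flip p \<bar>x\<bar> = - x"
  hence "(\<lambda>x. flip p \<bar>x\<bar>) ` B = (\<lambda>x. - x) ` B" by (intro image_cong) auto
  thus ?thesis by (simp add: image_image)
qed

lemma sym_lift_abs:
  assumes neg: "\<And>B. B \<in> R \<Longrightarrow> uminus ` B \<in> R" and one: "\<And>B. B \<in> R \<Longrightarrow> onesided p B"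
  shows "sym_lift (flip p) ((\<lambda>B. abs ` B) ` R) = R"
proof (intro equalityI subsetI)
  fix E assume "E \<in> sym_lift (flip p) ((\<lambda>B. abs ` B) ` R)"
  then obtain B where B: "B \<in> R" "E = flip p ` abs ` B \<or> E = uminus ` flip p ` abs ` B"
    unfolding sym_lift_def by blast
  have "E = B \<or> E = uminus ` B"
    using onesided_image[OF one[OF B(1)]] B(2) by (metis uminus_image_twice)
  thus "E \<in> R" using B(1) neg by blast
next
  fix B assume B: "B \<in> R"
  have "B = flip p ` abs ` B \<or> B = uminus ` flip p ` abs ` B"
    using onesided_image[OF one[OF B]] by (metis uminus_image_twice)
  thus "B \<in> sym_lift (flip p) ((\<lambda>B. abs ` B) ` R)" using B unfolding sym_lift_def by blast
qed

lemma abs_uminus_image: "abs ` uminus ` B = abs ` (B :: int set)"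
  by (simp add: image_image)

text \<open>For every block B of \<rho>, the elements of its absolute values, lifted by
  \<open>flip p\<close>, all lie in B or all in its negative (\<open>rep\<close>). So blocks of
  absolute values can be compared on a single half circle, where \<open>between_flip\<close>
  transfers noncrossing.\<close>

lemma fold_NC:
  assumes \<rho>: "\<rho> \<in> NCB m" and p: "0 \<le> p" and one: "\<And>B. B \<in> \<rho> \<Longrightarrow> zero_block B \<or> onesided p B"
  shows "(\<lambda>B. abs ` B) ` \<rho> \<in> NC m"
proof -
  have P: "partition_on ({- int m..int m} - {0}) \<rho>" and neg: "\<And>B. B \<in> \<rho> \<Longrightarrow> uminus ` B \<in> \<rho>"
    and nc: "noncrossing (cpos m) \<rho>"
    using \<rho> by (auto simp: NCB_iff PiB_def)
  have rep: "\<exists>B'\<in>\<rho>. abs ` B' = abs ` B \<and> (\<forall>x\<in>abs ` B. flip p x \<in> B')" if B: "B \<in> \<rho>" for B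
  proof -
    have "flip p ` abs ` B \<subseteq> B \<or> flip p ` abs ` B \<subseteq> uminus ` B"
    proof (cases "zero_block B")
      case True
      have "flip p \<bar>x\<bar> \<in> B" if "x \<in> B" for x
      proof -
        have "- x \<in> B" using True that unfolding zero_block_def by blast
        moreover have "flip p \<bar>x\<bar> = x \<or> flip p \<bar>x\<bar> = - x" by (auto simp: flip_def)
        ultimately show ?thesis using that by auto
      qed
      thus ?thesis by blast
    next
      case False
      thus ?thesis using onesided_image one[OF B] by blast
    qed
    thus ?thesis
    proof
      assume "flip p ` abs ` B \<subseteq> B"
      thus ?thesis using B by blast
    next
      assume "flip p ` abs ` B \<subseteq> uminus ` B"
      hence "\<forall>x\<in>abs ` B. flip p x \<in> uminus ` B" by blast
      thus ?thesis by (intro bexI[of _ "uminus ` B"] conjI abs_uminus_image neg[OF B])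
    qed
  qed
  have disj: "abs ` B = abs ` C" if H: "B \<in> \<rho>" "C \<in> \<rho>" "x \<in> abs ` B" "x \<in> abs ` C" for B C x
  proof -
    obtain B' where B': "B' \<in> \<rho>" "abs ` B' = abs ` B" "flip p x \<in> B'" using rep[OF H(1)] H(3) by blast
    obtain C' where C': "C' \<in> \<rho>" "abs ` C' = abs ` C" "flip p x \<in> C'" using rep[OF H(2)] H(4) by blast
    show ?thesis using partition_on_eq[OF P B'(1) C'(1) B'(3) C'(3)] B'(2) C'(2) by simp
  qed
  have sub: "abs ` B \<subseteq> {1..int m}" if "B \<in> \<rho>" for B
  proof -
    have "B \<subseteq> {- int m..int m} - {0}" using partition_onD1[OF P] that by blast
    hence "abs ` B \<subseteq> abs ` ({- int m..int m} - {0})" by (rule image_mono)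
    also have "\<dots> \<subseteq> {1..int m}" by auto
    finally show ?thesis .
  qed
  have "partition_on {1..int m} ((\<lambda>B. abs ` B) ` \<rho>)"
  proof (rule partition_onI)
    have "\<Union> ((\<lambda>B. abs ` B) ` \<rho>) = abs ` \<Union> \<rho>" by blast
    also have "\<dots> = abs ` ({- int m..int m} - {0})" using partition_onD1[OF P] by simp
    also have "\<dots> = {1..int m}"
    proof (intro equalityI subsetI)
      fix x assume "x \<in> {1..int m}"
      hence "x = \<bar>x\<bar>" "x \<in> {- int m..int m} - {0}" by auto
      thus "x \<in> abs ` ({- int m..int m} - {0})" by blast
    qed auto
    finally show "\<Union> ((\<lambda>B. abs ` B) ` \<rho>) = {1..int m}" .
    show "{} \<notin> (\<lambda>B. abs ` B) ` \<rho>" using partition_onD3[OF P] by auto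
    show "disjnt A A'" if H: "A \<in> (\<lambda>B. abs ` B) ` \<rho>" "A' \<in> (\<lambda>B. abs ` B) ` \<rho>" "A \<noteq> A'" for A A'
    proof (rule ccontr)
      assume "\<not> disjnt A A'"
      then obtain x where "x \<in> A" "x \<in> A'" by (auto simp: disjnt_def)
      moreover obtain B C where "B \<in> \<rho>" "A = abs ` B" "C \<in> \<rho>" "A' = abs ` C" using H by blast
      ultimately show False using disj[of B C x] H(3) by simp
    qed
  qed
  moreover have "noncrossing (\<lambda>x. x) ((\<lambda>B. abs ` B) ` \<rho>)"
    unfolding noncrossing_def
  proof (intro ballI impI)
    fix A A' a c b d
    assume "A \<in> (\<lambda>B. abs ` B) ` \<rho>" "A' \<in> (\<lambda>B. abs ` B) ` \<rho>"
    then obtain B C where BC: "B \<in> \<rho>" "A = abs ` B" "C \<in> \<rho>" "A' = abs ` C" by blast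
    assume ne: "A \<noteq> A'" and "a \<in> A" "c \<in> A" "b \<in> A'" "d \<in> A'"
    hence ac: "a \<in> abs ` B" "c \<in> abs ` B" and bd: "b \<in> abs ` C" "d \<in> abs ` C" using BC by auto
    have ran: "a \<in> {1..int m}" "b \<in> {1..int m}" "c \<in> {1..int m}" "d \<in> {1..int m}"
      using ac bd sub[OF BC(1)] sub[OF BC(3)] by blast+
    have neq: "a \<noteq> b" "a \<noteq> d" "c \<noteq> b" "c \<noteq> d"
      using disj[OF BC(1,3)] ac bd ne BC(2,4) by metis+
    obtain B' where B': "B' \<in> \<rho>" "abs ` B' = abs ` B" "flip p a \<in> B'" "flip p c \<in> B'"
      using rep[OF BC(1)] ac by blast
    obtain C' where C': "C' \<in> \<rho>" "abs ` C' = abs ` C" "flip p b \<in> C'" "flip p d \<in> C'"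
      using rep[OF BC(3)] bd by blast
    have "B' \<noteq> C'" using B'(2) C'(2) ne BC(2,4) by metis
    from noncrossingD[OF nc B'(1) C'(1) this B'(3,4) C'(3,4)]
    show "between a c b = between a c d" using between_flip(1)[OF p ran neq] by blast
  qed
  ultimately show ?thesis unfolding NC_iff by blast
qed

text \<open>A chord joining opposite points \<open>p\<close> and \<open>-p\<close> separates the two half circles.\<close>

lemma between_diameter:
  assumes "0 < p" "x \<noteq> 0" "\<bar>x\<bar> \<le> int m" "p \<le> int m" "\<bar>x\<bar> \<noteq> p"
  shows "between (cpos m p) (cpos m (- p)) (cpos m x) \<longleftrightarrow> flip p \<bar>x\<bar> = - x"
    and "\<not> between (cpos m p) (cpos m (- p)) (cpos m x) \<longleftrightarrow> flip p \<bar>x\<bar> = x"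
  using assms unfolding between_def cpos_def flip_def by (smt (verit))+

text \<open>Z contains both ends p and -p of a diameter, and no other block may meet both sides of
  it.\<close>

lemma onesided_zero:
  assumes \<rho>: "\<rho> \<in> NCB m" and Z: "Z \<in> \<rho>" "zero_block Z" "p \<in> Z" "0 < p" and B: "B \<in> \<rho>" "B \<noteq> Z"
  shows "onesided p B"
proof -
  have P: "partition_on ({- int m..int m} - {0}) \<rho>" and nc: "noncrossing (cpos m) \<rho>"
    using \<rho> by (auto simp: NCB_iff PiB_def)
  have mp: "- p \<in> Z" using Z unfolding zero_block_def by blast
  have ran: "x \<noteq> 0 \<and> \<bar>x\<bar> \<le> int m" if "x \<in> C" "C \<in> \<rho>" for x C
  proof -
    have "x \<in> {- int m..int m} - {0}" using partition_onD1[OF P] that by blast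
    thus ?thesis by auto
  qed
  have pm: "p \<le> int m" using ran[OF Z(3,1)] Z(4) by simp
  have dj: "\<bar>x\<bar> \<noteq> p" if "x \<in> B" for x
  proof
    assume "\<bar>x\<bar> = p"
    hence "x \<in> Z" using Z(3) mp by (metis abs_eq_iff abs_of_pos Z(4))
    thus False using partition_on_eq[OF P B(1) Z(1) that] B(2) by blast
  qed
  have bt: "between (cpos m p) (cpos m (- p)) (cpos m x) = between (cpos m p) (cpos m (- p)) (cpos m y)"
    if "x \<in> B" "y \<in> B" for x y
    using noncrossingD[OF nc Z(1) B(1) B(2)[symmetric] Z(3) mp that] .
  have bd: "between (cpos m p) (cpos m (- p)) (cpos m x) \<longleftrightarrow> flip p \<bar>x\<bar> = - x"
    "\<not> between (cpos m p) (cpos m (- p)) (cpos m x) \<longleftrightarrow> flip p \<bar>x\<bar> = x" if "x \<in> B" for x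
    using between_diameter[OF Z(4) _ _ pm dj[OF that]] ran[OF that B(1)] by auto
  show ?thesis unfolding onesided_def using bt bd by metis
qed

lemma nonzero_disjoint:
  assumes "\<rho> \<in> PiB m" "B \<in> \<rho>" "\<not> zero_block B" "x \<in> B"
  shows "- x \<notin> B"
proof
  assume "- x \<in> B"
  hence "x \<in> uminus ` B" using mem_uminus_image by blast
  moreover have "uminus ` B \<in> \<rho>" "partition_on ({- int m..int m} - {0}) \<rho>" using assms unfolding PiB_def by auto
  ultimately have "uminus ` B = B" using partition_on_eq assms(2,4) by metis
  thus False using assms(3) by (simp add: zero_block_def)
qed

text \<open>All negative elements x of S satisfy -x > a: otherwise -x < a < b, and a, x in S would
  alternate on the circle with -x, b in the negative of S.\<close>

lemma onesided_mixed:
  assumes \<rho>: "\<rho> \<in> NCB m" and S: "S \<in> \<rho>" "\<not> zero_block S"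
    and a: "a \<in> S" "0 < a" "\<And>x. x \<in> S \<Longrightarrow> 0 < x \<Longrightarrow> x \<le> a"
    and b: "- b \<in> S" "a < b"
  shows "onesided a S"
proof -
  have P: "\<rho> \<in> PiB m" and PP: "partition_on ({- int m..int m} - {0}) \<rho>" and nc: "noncrossing (cpos m) \<rho>"
    and neg: "uminus ` S \<in> \<rho>"
    using \<rho> S by (auto simp: NCB_iff PiB_def)
  have ne: "S \<noteq> uminus ` S" using S(2) by (auto simp: zero_block_def)
  have "flip a \<bar>x\<bar> = x" if x: "x \<in> S" for x
  proof (cases "0 < x")
    case True
    thus ?thesis using a(3)[OF x] by (simp add: flip_def)
  next
    case False
    have "x \<in> {- int m..int m} - {0}" using partition_onD1[OF PP] x S(1) by blast
    hence xr: "x < 0" "- int m \<le> x" using False by auto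
    have "- b \<in> {- int m..int m} - {0}" using partition_onD1[OF PP] b(1) S(1) by blast
    hence br: "b \<le> int m" by auto
    have "a < - x"
    proof (rule ccontr)
      assume "\<not> a < - x"
      moreover have "- x \<noteq> a" using nonzero_disjoint[OF P S a(1)] x by auto
      ultimately have lt: "- x < a" by linarith
      have "- x \<in> uminus ` S" "b \<in> uminus ` S" using x b(1) by (auto simp: mem_uminus_image)
      from noncrossingD[OF nc neg S(1) ne[symmetric] this a(1) x]
      show False using lt b(2) a(2) xr br unfolding between_def cpos_def by auto
    qed
    thus ?thesis using xr by (simp add: flip_def)
  qed
  thus ?thesis unfolding onesided_def by blast
qed

text \<open>If S has only one sign, p is its largest absolute value. Otherwise p is the smaller of
  the largest absolute values of its positive and its negative elements; negating S reduces one
  order of these two to the other.\<close>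

lemma onesided_exists:
  assumes \<rho>: "\<rho> \<in> NCB m" and S: "S \<in> \<rho>" "\<not> zero_block S"
  shows "\<exists>p\<in>abs ` S. 0 < p \<and> onesided p S"
proof -
  have P: "\<rho> \<in> PiB m" and PP: "partition_on ({- int m..int m} - {0}) \<rho>" and neg: "uminus ` S \<in> \<rho>"
    using \<rho> S by (auto simp: NCB_iff PiB_def)
  have zneg: "\<not> zero_block (uminus ` S)" using S(2) unfolding zero_block_def by (metis uminus_image_twice)
  have sub: "S \<subseteq> {- int m..int m} - {0}" using partition_onD1[OF PP] S(1) by blast
  have fin: "finite S" using sub finite_subset by blast
  have ne: "S \<noteq> {}" using partition_onD3[OF PP] S(1) by blast
  define as where "as = {x \<in> S. 0 < x}"
  define bs where "bs = {x. 0 < x \<and> - x \<in> S}"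
  have fas: "finite as" using fin by (simp add: as_def)
  have fbs: "finite bs"
  proof (rule finite_subset)
    show "bs \<subseteq> uminus ` S" by (auto simp: bs_def mem_uminus_image)
  qed (use fin in simp)
  have cases: "x \<in> as \<or> - x \<in> bs" if "x \<in> S" for x using that sub by (force simp: as_def bs_def)
  show ?thesis
  proof (cases "bs = {}")
    case True
    hence all: "0 < x" if "x \<in> S" for x using cases[OF that] by (auto simp: as_def)
    have M: "Max S \<in> S" using fin ne by simp
    have "onesided (Max S) S" unfolding onesided_def using all fin by (auto simp: flip_def less_imp_le)
    thus ?thesis using M all[OF M] by (metis abs_of_pos image_eqI)
  next
    case bne: False
    show ?thesis
    proof (cases "as = {}")
      case True
      hence all: "x < 0" if "x \<in> S" for x using cases[OF that] by (auto simp: bs_def)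
      have M: "Min S \<in> S" using fin ne by simp
      have "onesided (- Min S) S" unfolding onesided_def using all fin by (force simp: flip_def)
      thus ?thesis using M all[OF M] by (metis abs_of_neg image_eqI neg_0_less_iff_less)
    next
      case ane: False
      have Ma: "Max as \<in> S" "0 < Max as" "\<And>x. x \<in> S \<Longrightarrow> 0 < x \<Longrightarrow> x \<le> Max as"
        using Max_in[OF fas ane] Max_ge[OF fas] by (auto simp: as_def)
      have Mb: "- Max bs \<in> S" "0 < Max bs" "\<And>x. - x \<in> S \<Longrightarrow> 0 < x \<Longrightarrow> x \<le> Max bs"
        using Max_in[OF fbs bne] Max_ge[OF fbs] by (auto simp: bs_def)
      have "Max as \<noteq> Max bs" using nonzero_disjoint[OF P S Ma(1)] Mb(1) by auto
      then consider "Max as < Max bs" | "Max bs < Max as" by linarith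
      thus ?thesis
      proof cases
        case 1
        have "onesided (Max as) S" by (rule onesided_mixed[OF \<rho> S Ma Mb(1) 1])
        thus ?thesis using Ma by (metis abs_of_pos image_eqI)
      next
        case 2
        have "onesided (Max bs) (uminus ` S)"
          by (rule onesided_mixed[OF \<rho> neg zneg _ Mb(2) _ _ 2]) (use Ma Mb in \<open>simp_all add: mem_uminus_image\<close>)
        hence "onesided (Max bs) S" by (simp only: onesided_uminus)
        moreover have "Max bs \<in> abs ` S" using Mb by (metis abs_minus_cancel abs_of_pos image_eqI)
        ultimately show ?thesis using Mb(2) by blast
      qed
    qed
  qed
qed

text \<open>Without a zero block there is no diameter to read off. It is found just after the
  largest p such that p and some -b with b > p share a block, the innermost place where a block
  passes from positive to negative elements.\<close>

lemma onesided_all: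
  assumes \<rho>: "\<rho> \<in> NCB m" and nz: "\<And>B. B \<in> \<rho> \<Longrightarrow> \<not> zero_block B"
    and mixed: "B0 \<in> \<rho>" "u0 \<in> B0" "0 < u0" "- v0 \<in> B0" "0 < v0"
  obtains p q where "0 < p" "(p, q) \<in> edges ((\<lambda>B. abs ` B) ` \<rho>)" "\<And>C. C \<in> \<rho> \<Longrightarrow> onesided p C"
proof -
  have P: "\<rho> \<in> PiB m" and PP: "partition_on ({- int m..int m} - {0}) \<rho>" and nc: "noncrossing (cpos m) \<rho>"
    and neg: "\<And>B. B \<in> \<rho> \<Longrightarrow> uminus ` B \<in> \<rho>"
    using \<rho> by (auto simp: NCB_iff PiB_def)
  have ran: "x \<noteq> 0 \<and> - int m \<le> x \<and> x \<le> int m" if "x \<in> C" "C \<in> \<rho>" for x C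
  proof -
    have "x \<in> {- int m..int m} - {0}" using partition_onD1[OF PP] that by blast
    thus ?thesis by auto
  qed
  define T where "T = {a. \<exists>b. 0 < a \<and> a < b \<and> (\<exists>B\<in>\<rho>. a \<in> B \<and> - b \<in> B)}"
  \<comment> \<open>Negating C if necessary makes the smaller absolute value the positive
    one.\<close>
  have TI: "min u v \<in> T" if "C \<in> \<rho>" "u \<in> C" "- v \<in> C" "0 < u" "0 < v" for C u v
  proof -
    have "u \<noteq> v" using nonzero_disjoint[OF P that(1) nz[OF that(1)] that(2)] that(3) by auto
    then consider "u < v" | "v < u" by linarith
    thus ?thesis
    proof cases
      case 1
      thus ?thesis using that unfolding T_def by (auto simp: min_def)
    next
      case 2
      have "v \<in> uminus ` C" "- u \<in> uminus ` C" using that by (simp_all add: mem_uminus_image)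
      hence "v \<in> T" using neg[OF that(1)] that(5) 2 unfolding T_def by blast
      thus ?thesis using 2 by (simp add: min_def)
    qed
  qed
  have fT: "finite T"
  proof (rule finite_subset)
    show "T \<subseteq> {- int m..int m}" using ran unfolding T_def by fastforce
  qed simp
  have neT: "T \<noteq> {}" using TI[OF mixed(1,2,4,3,5)] by blast
  define p where "p = Max T"
  have "p \<in> T" using fT neT by (simp add: p_def)
  then obtain b0 B where p: "0 < p" "p < b0" "B \<in> \<rho>" "p \<in> B" "- b0 \<in> B" unfolding T_def by blast
  have pmax: "x \<le> p" if "x \<in> T" for x using fT that by (simp add: p_def)
  define Q where "Q = {b. p < b \<and> - b \<in> B}"
  have fQ: "finite Q"
  proof (rule finite_subset)
    show "Q \<subseteq> {- int m..int m}" using ran[OF _ p(3)] unfolding Q_def by force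
  qed simp
  define q where "q = Min Q"
  have "q \<in> Q" using fQ p unfolding q_def by (intro Min_in) (auto simp: Q_def)
  hence q: "p < q" "- q \<in> B" by (auto simp: Q_def)
  have qmin: "q \<le> y" if "p < y" "- y \<in> B" for y using fQ that by (auto simp: q_def Q_def)
  \<comment> \<open>B is one-sided for some r among its absolute values. The elements p and -q fix
    the orientation and give p \<le> r < q; then r lies in T, so maximality of p forces r =
    p.\<close>
  have B1: "flip p \<bar>x\<bar> = x" if "x \<in> B" for x
  proof -
    obtain r where r: "r \<in> abs ` B" "0 < r" "onesided r B" using onesided_exists[OF \<rho> p(3) nz[OF p(3)]] by blast
    from r(3) have "\<forall>x\<in>B. flip r \<bar>x\<bar> = x"
    proof (unfold onesided_def, elim disjE)
      assume "\<forall>x\<in>B. flip r \<bar>x\<bar> = - x"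
      hence "flip r \<bar>p\<bar> = - p" "flip r \<bar>- q\<bar> = - (- q)" using p(4) q(2) by blast+
      hence False using p(1) q(1) by (auto simp: flip_def split: if_splits)
      thus ?thesis ..
    qed
    note rB = this
    have "flip r \<bar>p\<bar> = p" "flip r \<bar>- q\<bar> = - q" using rB p(4) q(2) by blast+
    hence "p \<le> r" "r < q" using p(1) q(1) by (auto simp: flip_def split: if_splits)
    obtain z where z: "z \<in> B" "r = \<bar>z\<bar>" using r(1) by blast
    have "flip r r = r" by (simp add: flip_def)
    hence "z = r" using rB z by metis
    hence "min r q \<in> T" using TI[OF p(3) _ q(2) r(2)] z(1) p(1) q(1) by simp
    hence "r \<le> p" using pmax \<open>r < q\<close> by (simp add: min_def)
    hence "r = p" using \<open>p \<le> r\<close> by simp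
    thus ?thesis using rB that by blast
  qed
  have one: "onesided p C" if C: "C \<in> \<rho>" for C
  proof (cases "C = B \<or> C = uminus ` B")
    case True
    have "onesided p B" using B1 unfolding onesided_def by blast
    thus ?thesis using True onesided_uminus by blast
  next
    case False
    show ?thesis
    proof (rule ccontr)
      assume "\<not> onesided p C"
      then obtain x y where xy: "x \<in> C" "y \<in> C" "flip p \<bar>x\<bar> \<noteq> - x" "flip p \<bar>y\<bar> \<noteq> y"
        unfolding onesided_def by blast
      have neq: "C \<noteq> B" "C \<noteq> uminus ` B" using False by auto
      \<comment> \<open>The opposite chords from p to -q and from q to -p bound a strip around the
        diameter. As C crosses neither, x and y on different sides of the diameter both lie in the
        strip with p < -x and p < y, which contradicts the maximality of p.\<close>
      have mB: "q \<in> uminus ` B" "- p \<in> uminus ` B" using p(4) q(2) by (simp_all add: mem_uminus_image)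
      have n1: "between (cpos m p) (cpos m (- q)) (cpos m x) = between (cpos m p) (cpos m (- q)) (cpos m y)"
        using noncrossingD[OF nc p(3) C neq(1)[symmetric] p(4) q(2) xy(1,2)] .
      have n2: "between (cpos m q) (cpos m (- p)) (cpos m x) = between (cpos m q) (cpos m (- p)) (cpos m y)"
        using noncrossingD[OF nc neg[OF p(3)] C neq(2)[symmetric] mB xy(1,2)] .
      have d: "z \<noteq> p" "z \<noteq> - q" "z \<noteq> q" "z \<noteq> - p" if "z \<in> C" for z
        using partition_on_eq[OF PP C p(3) that] partition_on_eq[OF PP C neg[OF p(3)] that] p(4) q(2) mB neq by blast+
      have "0 < y \<and> p < y \<and> x < 0 \<and> p < - x"
        using n1 n2 d[OF xy(1)] d[OF xy(2)] xy(3,4) ran[OF xy(1) C] ran[OF xy(2) C] p(1) q(1)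
          ran[OF q(2) p(3)]
        unfolding between_def cpos_def flip_def by (smt (verit))
      moreover from this have "min y (- x) \<in> T" using TI[OF C xy(2), of "- x"] xy(1) by simp
      ultimately show False using pmax[of "min y (- x)"] by (auto simp: min_def split: if_splits)
    qed
  qed
  have "(p, q) \<in> edges ((\<lambda>B. abs ` B) ` \<rho>)"
  proof -
    have "p \<in> abs ` B" "q \<in> abs ` B" using p(1,4) q by (force simp: image_iff)+
    moreover have "\<not> (\<exists>k\<in>abs ` B. p < k \<and> k < q)"
    proof
      assume "\<exists>k\<in>abs ` B. p < k \<and> k < q"
      then obtain z where z: "z \<in> B" "p < \<bar>z\<bar>" "\<bar>z\<bar> < q" by blast
      have "z = - \<bar>z\<bar>" using B1[OF z(1)] z(2) by (auto simp: flip_def)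
      hence "q \<le> \<bar>z\<bar>" using qmin[OF z(2)] z(1) by simp
      thus False using z(3) by simp
    qed
    ultimately show ?thesis using p(3) q(1) unfolding edges_def by blast
  qed
  thus thesis using that p(1) one by blast
qed

section \<open>The inverse map\<close>

text \<open>Together with \<open>zero_lift\<close>, the partitions of the two lift locales, restated
  without locale hypotheses so that \<open>psi_inv\<close> is a total function.\<close>

definition core_lift :: "nat \<Rightarrow> (int \<Rightarrow> int) \<Rightarrow> int set set \<Rightarrow> int set \<Rightarrow> int set set" where
  "core_lift n f \<sigma> K = sym_lift f (insert (insert (int n) K) (\<sigma> - {K}))"

definition zero_lift :: "nat \<Rightarrow> int \<Rightarrow> int set set \<Rightarrow> int set \<Rightarrow> int set set" where
  "zero_lift n p \<sigma> K = sym_lift (flip p) (\<sigma> - {K}) \<union> {{x. \<bar>x\<bar> \<in> insert (int n) K}}"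

text \<open>
  In the first two cases \<open>{n}\<close> and \<open>{-n}\<close> become blocks.  In the last case \<open>\<bar>i\<bar>\<close> is always lifted to itself,
  so the sign of the lift of \<open>n\<close> decides whether \<open>n\<close> joins the block of \<open>i\<close> or that of \<open>-i\<close>.
\<close>

definition psi_inv :: "nat \<Rightarrow> int set set \<times> mark \<Rightarrow> int set set" where
  "psi_inv n = (\<lambda>(\<sigma>, x). case x of
     MEmpty \<Rightarrow> core_lift n (flip 0) \<sigma> {}
   | MEdge e \<Rightarrow> core_lift n (flip (fst e)) \<sigma> {}
   | MBlock B \<Rightarrow> zero_lift n (Max B) \<sigma> B
   | MInt i \<Rightarrow> core_lift n ((flip \<bar>i\<bar>)(int n := sgn i * int n)) \<sigma> (THE B. B \<in> \<sigma> \<and> \<bar>i\<bar> \<in> B))"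

definition type_rule :: "int set set \<Rightarrow> int set set \<times> mark \<Rightarrow> bool" where
  "type_rule \<pi> = (\<lambda>(\<sigma>, x).
      (x = MEmpty \<or> (\<exists>e. x = MEdge e) \<longrightarrow> typeB \<pi> = type_of \<sigma> + {#1#}) \<and>
      (\<forall>B. x = MBlock B \<longrightarrow> typeB \<pi> = type_of (\<sigma> - {B})) \<and>
      (\<forall>i B. x = MInt i \<and> B \<in> \<sigma> \<and> \<bar>i\<bar> \<in> B \<longrightarrow>
         typeB \<pi> = type_of (\<sigma> - {B}) + {#card B + 1#}))"

lemma the_block:
  assumes "\<sigma> \<in> NC m" "B \<in> \<sigma>" "i \<in> B"
  shows "(THE B. B \<in> \<sigma> \<and> i \<in> B) = B"
proof (rule the_equality)
  have "partition_on {1..int m} \<sigma>" using assms(1) by (simp add: NC_iff)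
  thus "C = B" if "C \<in> \<sigma> \<and> i \<in> C" for C using partition_on_eq assms(2,3) that by metis
qed (use assms in blast)

lemma abs_flip: "\<bar>flip p x\<bar> = \<bar>x\<bar>"
  by (simp add: flip_def)

lemma psiD_psi_inv:
  assumes "(\<sigma>, x) \<in> DD (Suc m)"
  shows "psi_inv (Suc m) (\<sigma>, x) \<in> NCD (Suc m) \<and> psiD (Suc m) (psi_inv (Suc m) (\<sigma>, x)) = (\<sigma>, x) \<and>
    type_rule (psi_inv (Suc m) (\<sigma>, x)) (\<sigma>, x)"
proof -
  have NC: "\<sigma> \<in> NC m" using assms by (simp add: DD_def)
  hence part: "partition_on {1..int m} \<sigma>" by (simp add: NC_iff)
  have emp: "\<sigma> - {{}} = \<sigma>" using partition_onD3[OF part] by blast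
  have sub: "B \<subseteq> {1..int m}" if "B \<in> \<sigma>" for B using partition_onD1[OF part] that by blast
  show ?thesis
  proof (cases x)
    case MEmpty
    interpret lift_nonzero m \<sigma> 0 "{}" "flip 0"
      by unfold_locales (use NC in \<open>auto simp: abs_flip\<close>)
    have eq: "psi_inv (Suc m) (\<sigma>, x) = \<pi>" by (simp add: psi_inv_def core_lift_def MEmpty)
    \<comment> \<open>With p = 0 nothing lies below the diameter, so no block is split.\<close>
    have "low B = {}" if "B \<in> \<sigma>" for B using sub[OF that] by (auto simp: low_def)
    hence "split = {}" by (auto simp: split_def)
    hence "psiD (Suc m) \<pi> = (\<sigma>, MEmpty)"
      unfolding psiD_def comp_def phi_eq_singleton[OF refl] by (rule varphi_empty[OF refl])
    thus ?thesis unfolding eq using NCD type_eq MEmpty emp by (simp add: type_rule_def)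
  next
    case (MEdge e)
    obtain a b where e: "e = (a, b)" by (cases e)
    have ab: "(a, b) \<in> edges \<sigma>" using assms MEdge e by (simp add: DD_def)
    then obtain B where "B \<in> \<sigma>" "a \<in> B" unfolding edges_def by blast
    hence "0 \<le> a" using sub[of B] by auto
    then interpret lift_nonzero m \<sigma> a "{}" "flip a"
      by unfold_locales (use NC in \<open>auto simp: abs_flip\<close>)
    have eq: "psi_inv (Suc m) (\<sigma>, x) = \<pi>" by (simp add: psi_inv_def core_lift_def MEdge e)
    have "psiD (Suc m) \<pi> = (\<sigma>, MEdge (a, b))"
      unfolding psiD_def comp_def phi_eq_singleton[OF refl] by (rule varphi_edge[OF refl ab])
    thus ?thesis unfolding eq using NCD type_eq MEdge e emp by (simp add: type_rule_def)
  next
    case (MBlock B)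
    have B: "B \<in> \<sigma>" using assms MBlock by (simp add: DD_def)
    have fin: "finite B" using sub[OF B] finite_subset by blast
    have ne: "B \<noteq> {}" using partition_onD3[OF part] B by blast
    have M: "Max B \<in> B" using fin ne by simp
    hence "0 \<le> Max B" using sub[OF B] by auto
    then interpret lift_zero m \<sigma> "Max B" B
      by unfold_locales (use NC B M in auto)
    have eq: "psi_inv (Suc m) (\<sigma>, x) = \<pi>" by (simp add: psi_inv_def zero_lift_def MBlock)
    have u: "upp B = {}" using Max_ge[OF fin] by (force simp: upp_def)
    have "psiD (Suc m) \<pi> = (\<sigma>, MBlock B)"
      unfolding psiD_def comp_def phi_eq[OF u] by (rule varphi_block[OF ne u])
    thus ?thesis unfolding eq using NCD type_eq MBlock by (simp add: type_rule_def)
  next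
    case (MInt i)
    have i: "i \<in> {- int m..int m} - {0}" using assms MInt by (simp add: DD_def)
    hence "\<bar>i\<bar> \<in> \<Union> \<sigma>" using partition_onD1[OF part, symmetric] by auto
    then obtain B where B: "B \<in> \<sigma>" "\<bar>i\<bar> \<in> B" by blast
    let ?N = "int (Suc m)"
    let ?f = "(flip \<bar>i\<bar>)(?N := sgn i * ?N)"
    have the: "(THE B. B \<in> \<sigma> \<and> \<bar>i\<bar> \<in> B) = B" by (rule the_block[OF NC B])
    have fi: "\<bar>?f ?N\<bar> = ?N" using i by (simp add: abs_mult sgn_if)
    interpret lift_nonzero m \<sigma> "\<bar>i\<bar>" B ?f
      by unfold_locales (use NC B fi in auto)
    have eq: "psi_inv (Suc m) (\<sigma>, x) = \<pi>" unfolding psi_inv_def core_lift_def MInt prod.case mark.case the ..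
    have ne: "B \<noteq> {}" using B by blast
    have sg: "(if ?f ?N = ?N then 1 else - 1 :: int) = sgn i" using i by (simp add: sgn_if)
    have "sgn i \<in> {-1, 1}" using i by (simp add: sgn_if)
    from varphi_int[OF ne this] have "psiD (Suc m) \<pi> = (\<sigma>, MInt i)"
      unfolding psiD_def comp_def phi_eq[OF ne] sg by (simp add: sgn_mult_abs)
    moreover have "C = B" if "C \<in> \<sigma>" "\<bar>i\<bar> \<in> C" for C using partition_on_eq[OF part that(1) B(1) that(2) B(2)] .
    ultimately show ?thesis unfolding eq using NCD type_eq MInt by (auto simp: type_rule_def)
  qed
qed

section \<open>Surjectivity of the inverse map\<close>

lemma same_abs_block:
  fixes \<pi> :: "int set set"
  assumes P: "partition_on A \<pi>" and "B \<in> \<pi>" "S \<in> \<pi>" "uminus ` S \<in> \<pi>" "S' \<subseteq> S" "x \<in> S'" "\<bar>x\<bar> \<in> abs ` B"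
  shows "B = S \<or> B = uminus ` S"
proof -
  obtain y where y: "y \<in> B" "\<bar>x\<bar> = \<bar>y\<bar>" using assms(7) by blast
  have "y = x \<or> y = - x" using y(2) by linarith
  thus ?thesis
  proof
    assume "y = x"
    thus ?thesis using partition_on_eq[OF P assms(2,3) y(1)] assms(5,6) by blast
  next
    assume "y = - x"
    hence "y \<in> uminus ` S" using assms(5,6) by (auto simp: mem_uminus_image)
    thus ?thesis using partition_on_eq[OF P assms(2,4) y(1)] by blast
  qed
qed

locale NCD_partition =
  fixes m :: nat and \<pi> :: "int set set"
  assumes pi: "\<pi> \<in> NCD (Suc m)"
begin

abbreviation "N \<equiv> int (Suc m)"

lemma PiB: "\<pi> \<in> PiB (Suc m)"
  and merge: "merge_pm (Suc m) \<pi> \<in> NCB m"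
  and delete: "delete_pm (Suc m) \<pi> \<in> NCB m"
  and zero: "\<And>B. B \<in> \<pi> \<Longrightarrow> zero_block B \<Longrightarrow> {N, - N} \<subset> B"
  using pi by (auto simp: NCD_def)

lemma PP: "partition_on ({- N..N} - {0}) \<pi>"
  and neg: "B \<in> \<pi> \<Longrightarrow> uminus ` B \<in> \<pi>"
  using PiB by (auto simp: PiB_def)

lemma blk: "B \<in> \<pi> \<Longrightarrow> C \<in> \<pi> \<Longrightarrow> x \<in> B \<Longrightarrow> x \<in> C \<Longrightarrow> B = C"
  using partition_on_eq[OF PP] .

lemma nonempty: "{} \<notin> \<pi>"
  using partition_onD3[OF PP] .

lemma elem: "B \<in> \<pi> \<Longrightarrow> x \<in> B \<Longrightarrow> x \<noteq> 0 \<and> \<bar>x\<bar> \<le> N"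
proof -
  assume "B \<in> \<pi>" "x \<in> B"
  hence "x \<in> {- N..N} - {0}" using partition_onD1[OF PP] by blast
  thus ?thesis by auto
qed

lemma psi_inv_zero:
  assumes Z: "Z \<in> \<pi>" "zero_block Z"
  shows "\<exists>y\<in>DD (Suc m). \<pi> = psi_inv (Suc m) y"
proof -
  define R where "R = \<pi> - {Z}"
  define Z' where "Z' = Z - {N, - N}"
  have NZ: "N \<in> Z" "- N \<in> Z" "Z' \<noteq> {}" using zero[OF Z] by (auto simp: Z'_def)
  have symZ: "- x \<in> Z" if "x \<in> Z" for x using Z(2) that unfolding zero_block_def by blast
  have symZ': "- x \<in> Z'" if "x \<in> Z'" for x using symZ that by (auto simp: Z'_def)
  have zZ': "zero_block Z'" unfolding zero_block_def
    using symZ' by (auto simp: mem_uminus_image)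
  have RN: "N \<notin> B \<and> - N \<notin> B" if "B \<in> R" for B
    using blk[OF _ Z(1)] NZ that unfolding R_def by blast
  have piR: "\<pi> = R \<union> {Z}" using Z by (auto simp: R_def)
  have "delete_pm (Suc m) \<pi> = R \<union> {Z'}"
  proof -
    have "(\<lambda>B. B - {N, - N}) ` R = (\<lambda>B. B) ` R" by (rule image_cong[OF refl]) (use RN in blast)
    hence "(\<lambda>B. B - {N, - N}) ` \<pi> = R \<union> {Z'}" unfolding piR Z'_def by (simp add: image_Un)
    moreover have "{} \<notin> R \<union> {Z'}" using nonempty NZ(3) by (auto simp: R_def)
    ultimately show ?thesis unfolding delete_pm_def by simp
  qed
  hence \<rho>: "R \<union> {Z'} \<in> NCB m" using delete by simp
  define K where "K = abs ` Z'"
  have "finite Z'"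
  proof (rule finite_subset)
    show "Z' \<subseteq> {- N..N}" using partition_onD1[OF PP] Z(1) unfolding Z'_def by blast
  qed simp
  hence pK: "Max K \<in> K" using NZ(3) by (simp add: K_def)
  \<comment> \<open>The value that \<open>psi_inv\<close> uses for a block mark. By symmetry Z'
    contains both p and -p, so it supplies the diameter.\<close>
  define p where "p = Max K"
  have "p \<in> Z'" "0 < p"
  proof -
    obtain z where z: "z \<in> Z'" "p = \<bar>z\<bar>" using pK by (auto simp: K_def p_def)
    thus "p \<in> Z'" using symZ' by (cases "0 \<le> z") (auto simp: abs_if)
    show "0 < p" using z elem[OF Z(1), of z] by (simp add: Z'_def)
  qed
  have ne: "B \<noteq> Z'" if "B \<in> R" for B
    using blk[OF _ Z(1)] that NZ(3) unfolding R_def Z'_def by blast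
  have one: "onesided p B" if "B \<in> R" for B
    by (rule onesided_zero[OF \<rho> _ zZ' \<open>p \<in> Z'\<close> \<open>0 < p\<close> _ ne]) (use that in auto)
  define \<sigma> where "\<sigma> = (\<lambda>B. abs ` B) ` (R \<union> {Z'})"
  have \<sigma>: "\<sigma> \<in> NC m" unfolding \<sigma>_def
    by (rule fold_NC[OF \<rho>, of p]) (use one zZ' \<open>0 < p\<close> in auto)
  have "K \<notin> (\<lambda>B. abs ` B) ` R"
  proof
    assume "K \<in> (\<lambda>B. abs ` B) ` R"
    then obtain B where B: "B \<in> R" "K = abs ` B" by blast
    obtain x where x: "x \<in> Z'" using NZ(3) by blast
    have xB: "\<bar>x\<bar> \<in> abs ` B" unfolding B(2)[symmetric] K_def using x by blast
    have "uminus ` Z = Z" using Z(2) by (simp add: zero_block_def)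
    hence "B = Z" using same_abs_block[OF PP _ Z(1) _ _ x xB] neg[OF Z(1)] B(1) by (auto simp: R_def Z'_def)
    thus False using B(1) by (simp add: R_def)
  qed
  hence sK: "\<sigma> - {K} = (\<lambda>B. abs ` B) ` R" by (auto simp: \<sigma>_def K_def)
  have "sym_lift (flip p) (\<sigma> - {K}) = R" unfolding sK
  proof (rule sym_lift_abs[OF _ one])
    show "uminus ` B \<in> R" if "B \<in> R" for B
    proof -
      have "uminus ` B \<noteq> Z"
      proof
        assume "uminus ` B = Z"
        hence "B = uminus ` Z" using uminus_image_twice by metis
        thus False using that Z(2) by (simp add: R_def zero_block_def)
      qed
      thus ?thesis using neg that by (simp add: R_def)
    qed
  qed
  moreover have "{x. \<bar>x\<bar> \<in> insert N K} = Z"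
  proof (intro equalityI subsetI)
    fix x assume "x \<in> {x. \<bar>x\<bar> \<in> insert N K}"
    hence "\<bar>x\<bar> = N \<or> \<bar>x\<bar> \<in> K" by simp
    thus "x \<in> Z"
    proof
      assume "\<bar>x\<bar> = N"
      hence "x = N \<or> x = - N" by linarith
      thus ?thesis using NZ by blast
    next
      assume "\<bar>x\<bar> \<in> K"
      then obtain z where z: "z \<in> Z'" "\<bar>x\<bar> = \<bar>z\<bar>" by (auto simp: K_def)
      have "x = z \<or> x = - z" using z(2) by linarith
      thus ?thesis using z(1) symZ by (auto simp: Z'_def)
    qed
  next
    fix x assume x: "x \<in> Z"
    show "x \<in> {x. \<bar>x\<bar> \<in> insert N K}"
    proof (cases "x \<in> Z'")
      case True
      thus ?thesis by (simp add: K_def)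
    next
      case False
      hence "x = N \<or> x = - N" using x by (auto simp: Z'_def)
      thus ?thesis by auto
    qed
  qed
  ultimately have "zero_lift (Suc m) p \<sigma> K = \<pi>" unfolding zero_lift_def using piR by simp
  hence "\<pi> = psi_inv (Suc m) (\<sigma>, MBlock K)" by (simp add: psi_inv_def p_def)
  moreover have "(\<sigma>, MBlock K) \<in> DD (Suc m)" using \<sigma> by (simp add: DD_def \<sigma>_def K_def)
  ultimately show ?thesis by blast
qed

text \<open>If n is alone, the diameter comes from the other blocks: p = 0 if none of them contains
  both signs, and the left end of an edge otherwise. If n has companions, they determine p and the
  mark is an integer.\<close>

lemma psi_inv_nonzero:
  assumes nz: "\<And>B. B \<in> \<pi> \<Longrightarrow> \<not> zero_block B"
  shows "\<exists>y\<in>DD (Suc m). \<pi> = psi_inv (Suc m) y"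
proof -
  have "N \<in> {- N..N} - {0}" by simp
  then obtain S where S: "S \<in> \<pi>" "N \<in> S" using partition_onD1[OF PP] by blast
  define T where "T = uminus ` S"
  have T: "T \<in> \<pi>" "- N \<in> T"
    unfolding T_def using neg[OF S(1)] S(2) by blast+
  have dS: "- x \<notin> S" if "x \<in> S" for x using nonzero_disjoint[OF PiB S(1) nz[OF S(1)] that] .
  have NT: "- N \<notin> S" "N \<notin> T" using dS[OF S(2)] by (auto simp: T_def mem_uminus_image)
  define R where "R = \<pi> - {S, T}"
  define S' where "S' = S - {N}"
  have S'S: "S' \<subseteq> S" "S - {N, - N} = S'" "S = insert N S'" using S NT by (auto simp: S'_def)
  have T': "T - {N, - N} = uminus ` S'" unfolding T_def S'_def using NT(1)
    by (auto simp: mem_uminus_image)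
  have piR: "\<pi> = R \<union> {S, T}" using S T by (auto simp: R_def)
  have RN: "N \<notin> B \<and> - N \<notin> B" if "B \<in> R" for B
    using blk[OF _ S(1)] blk[OF _ T(1)] S(2) T(2) that unfolding R_def by blast
  have Rneg: "uminus ` B \<in> R" if "B \<in> R" for B
  proof -
    have "B = T" if "uminus ` B = S"
      using arg_cong[OF that, of "image uminus"] unfolding uminus_image_twice T_def .
    moreover have "B = S" if "uminus ` B = T"
      using arg_cong[OF that, of "image uminus"] unfolding uminus_image_twice T_def .
    ultimately have "uminus ` B \<noteq> S" "uminus ` B \<noteq> T" using that unfolding R_def by blast+
    thus ?thesis using neg that by (simp add: R_def)
  qed
  have Rne: "{} \<notin> R" using nonempty by (simp add: R_def)
  have imR: "(\<lambda>B. B - {N, - N}) ` R = R"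
  proof -
    have "(\<lambda>B. B - {N, - N}) ` R = (\<lambda>B. B) ` R" by (rule image_cong[OF refl]) (use RN in blast)
    thus ?thesis by simp
  qed
  have "(\<lambda>B. B - {N, - N}) ` \<pi> = R \<union> {S', uminus ` S'}" unfolding piR image_Un imR
    by (simp only: image_insert image_empty S'S(2) T')
  hence del: "delete_pm (Suc m) \<pi> = R \<union> ({S', uminus ` S'} - {{}})"
    unfolding delete_pm_def by (simp only: Un_Diff_empty[OF Rne])
  have flipN: "flip p N = N \<or> flip p N = - N" for p by (auto simp: flip_def)
  show ?thesis
  proof (cases "S' = {}")
    case True
    hence ST: "S = {N}" "T = {- N}" using S'S(3) by (simp_all add: T_def)
    have \<rho>: "R \<in> NCB m" using delete unfolding del True by simp
    define \<sigma> where "\<sigma> = (\<lambda>B. abs ` B) ` R"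
    have emp: "\<sigma> - {{}} = \<sigma>" using Rne by (auto simp: \<sigma>_def)
    have lift: "core_lift (Suc m) (flip p) \<sigma> {} = \<pi>" if "\<And>B. B \<in> R \<Longrightarrow> onesided p B" for p
    proof -
      have R: "sym_lift (flip p) \<sigma> = R" unfolding \<sigma>_def by (rule sym_lift_abs[OF Rneg that])
      have ins: "sym_lift (flip p) (insert {N} \<sigma>) = {{flip p N}, {- flip p N}} \<union> sym_lift (flip p) \<sigma>"
        by (simp add: sym_lift_def)
      have "{{flip p N}, {- flip p N}} = {S, T}" using flipN[of p] unfolding ST by auto
      thus ?thesis unfolding core_lift_def emp piR ins R by (simp only: Un_commute)
    qed
    have fold: "\<sigma> \<in> NC m" if "\<And>B. B \<in> R \<Longrightarrow> onesided p B" "0 \<le> p" for p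
      unfolding \<sigma>_def by (rule fold_NC[OF \<rho> that(2)]) (use that(1) in blast)
    show ?thesis
    proof (cases "\<exists>B\<in>R. \<exists>u\<in>B. 0 < u \<and> (\<exists>v. 0 < v \<and> - v \<in> B)")
      case False
      have one: "onesided 0 B" if B: "B \<in> R" for B
      proof -
        have "x \<noteq> 0" if "x \<in> B" for x using elem[OF _ that] B by (auto simp: R_def)
        moreover have "(\<forall>x\<in>B. x \<le> 0) \<or> (\<forall>x\<in>B. 0 \<le> x)"
        proof (rule ccontr)
          assume "\<not> ?thesis"
          then obtain u w where uw: "u \<in> B" "0 < u" "w \<in> B" "w < 0" by force
          hence "0 < - w" "- (- w) \<in> B" by auto
          thus False using False B uw by blast
        qed
        ultimately show ?thesis unfolding onesided_def flip_def by (auto simp: abs_if)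
      qed
      have "\<pi> = psi_inv (Suc m) (\<sigma>, MEmpty)" using lift[OF one] by (simp add: psi_inv_def)
      moreover have "(\<sigma>, MEmpty) \<in> DD (Suc m)" using fold[OF one] by (simp add: DD_def)
      ultimately show ?thesis by blast
    next
      case True
      then obtain B u v where B: "B \<in> R" "u \<in> B" "0 < u" "- v \<in> B" "0 < v" by blast
      have nzR: "\<not> zero_block B" if "B \<in> R" for B using nz that by (simp add: R_def)
      obtain p q where pq: "0 < p" "(p, q) \<in> edges ((\<lambda>B. abs ` B) ` R)" "\<And>C. C \<in> R \<Longrightarrow> onesided p C"
        using onesided_all[OF \<rho> nzR B] by blast
      have "\<pi> = psi_inv (Suc m) (\<sigma>, MEdge (p, q))" using lift[OF pq(3)] by (simp add: psi_inv_def)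
      moreover have "(\<sigma>, MEdge (p, q)) \<in> DD (Suc m)" using fold[OF pq(3)] pq(1,2) by (simp add: DD_def \<sigma>_def)
      ultimately show ?thesis by blast
    qed
  next
    case False
    have "{} \<notin> {S', uminus ` S'}" using False by simp
    hence "delete_pm (Suc m) \<pi> = R \<union> {S', uminus ` S'}" unfolding del by simp
    hence \<rho>: "R \<union> {S', uminus ` S'} \<in> NCB m" using delete by simp
    have nS': "\<not> zero_block S'"
    proof
      assume "zero_block S'"
      moreover obtain x where "x \<in> S'" using False by blast
      ultimately have "- x \<in> S'" unfolding zero_block_def by blast
      thus False using dS S'S(1) \<open>x \<in> S'\<close> by blast
    qed
    obtain p where p: "p \<in> abs ` S'" "0 < p" "onesided p S'"
      using onesided_exists[OF \<rho> _ nS'] by blast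
    \<comment> \<open>Deleting n and -n has given p and the one-sidedness of S'. Merging instead
      makes Z a zero block containing p, which forces every remaining block to be one-sided for the
      same p.\<close>
    define Z where "Z = S' \<union> uminus ` S'"
    have mg: "merge_pm (Suc m) \<pi> = R \<union> {Z}"
    proof -
      have "{B \<in> \<pi>. N \<notin> B \<and> - N \<notin> B} = R" unfolding piR using RN S(2) T(2) by blast
      moreover have "{B \<in> \<pi>. N \<in> B \<or> - N \<in> B} = {S, T}" unfolding piR using RN S(2) T(2) by blast
      moreover have "\<Union> {S, T} - {N, - N} = Z" unfolding Z_def using S'S(2) T' by blast
      moreover have "Z \<noteq> {}" using False by (simp add: Z_def)
      ultimately show ?thesis unfolding merge_pm_def using Rne by simp
    qed
    have \<rho>': "R \<union> {Z} \<in> NCB m" using merge unfolding mg .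
    have zZ: "zero_block Z" unfolding zero_block_def Z_def image_Un uminus_image_twice by (rule Un_commute)
    have pZ: "p \<in> Z"
    proof -
      obtain z where z: "z \<in> S'" "p = \<bar>z\<bar>" using p(1) by blast
      have "p = z \<or> p = - z" using z(2) by linarith
      thus ?thesis using z(1) by (auto simp: Z_def mem_uminus_image)
    qed
    have ne: "B \<noteq> Z" if "B \<in> R" for B
      using blk[OF _ S(1)] that False S'S(1) unfolding R_def Z_def by blast
    have one: "onesided p B" if "B \<in> R" for B
      by (rule onesided_zero[OF \<rho>' _ zZ pZ p(2) _ ne]) (use that in auto)
    define K where "K = abs ` S'"
    define \<sigma> where "\<sigma> = (\<lambda>B. abs ` B) ` (R \<union> {S', uminus ` S'})"
    have \<sigma>: "\<sigma> \<in> NC m" unfolding \<sigma>_def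
    proof (rule fold_NC[OF \<rho>, of p])
      show "zero_block B \<or> onesided p B" if "B \<in> R \<union> {S', uminus ` S'}" for B
        using that one p(3) onesided_uminus by blast
    qed (use p(2) in simp)
    have "K \<notin> (\<lambda>B. abs ` B) ` R"
    proof
      assume "K \<in> (\<lambda>B. abs ` B) ` R"
      then obtain B where B: "B \<in> R" "K = abs ` B" by blast
      obtain x where x: "x \<in> S'" using False by blast
      have xB: "\<bar>x\<bar> \<in> abs ` B" unfolding B(2)[symmetric] K_def using x by blast
      have "B \<in> \<pi>" using B(1) by (simp add: R_def)
      from same_abs_block[OF PP this S(1) neg[OF S(1)] S'S(1) x xB] have "B = S \<or> B = T"
        unfolding T_def .
      thus False using B(1) by (simp add: R_def)
    qed
    hence sK: "\<sigma> - {K} = (\<lambda>B. abs ` B) ` R" by (auto simp: \<sigma>_def K_def abs_uminus_image)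
    have Ks: "K \<in> \<sigma>" by (simp add: \<sigma>_def K_def)
    have Ksub: "K \<subseteq> {1..int m}" using partition_onD1[of "{1..int m}" \<sigma>] \<sigma> Ks by (auto simp: NC_iff)
    \<comment> \<open>Exactly one of S' and its negative contains p, and that one is the image of K
      under \<open>flip p\<close>. The sign of v records whether n or -n is attached to it.\<close>
    define v where "v = (if p \<in> S' then p else - p)"
    have av: "\<bar>v\<bar> = p" "v \<noteq> 0" using p(2) by (auto simp: v_def)
    define f where "f = (flip p)(N := sgn v * N)"
    have "sym_lift f (\<sigma> - {K}) = sym_lift (flip p) (\<sigma> - {K})"
    proof (rule sym_lift_cong)
      fix B x assume "B \<in> \<sigma> - {K}" "x \<in> B"
      hence "x \<in> {1..int m}" using partition_onD1[of "{1..int m}" \<sigma>] \<sigma> by (auto simp: NC_iff)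
      thus "f x = flip p x" by (simp add: f_def)
    qed
    also have "\<dots> = R" unfolding sK by (rule sym_lift_abs[OF Rneg one])
    finally have fR: "sym_lift f (\<sigma> - {K}) = R" .
    have fK: "f ` insert N K = insert (sgn v * N) (flip p ` K)"
    proof -
      have "f ` K = flip p ` K" by (rule image_cong[OF refl]) (use Ksub in \<open>auto simp: f_def\<close>)
      moreover have "f N = sgn v * N" by (simp add: f_def)
      ultimately show ?thesis by (simp only: image_insert)
    qed
    have pf: "p \<in> flip p ` K"
    proof (rule image_eqI)
      show "p = flip p p" by (simp add: flip_def)
      show "p \<in> K" using p(1) by (simp add: K_def)
    qed
    have fl: "flip p ` K = S' \<or> flip p ` K = uminus ` S'" unfolding K_def by (rule onesided_image[OF p(3)])
    have "{f ` insert N K, uminus ` f ` insert N K} = {S, T}"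
    proof (cases "p \<in> S'")
      case True
      have "p \<notin> uminus ` S'" using dS S'S(1) True by (auto simp: mem_uminus_image)
      hence "flip p ` K = S'" using fl pf by blast
      hence "f ` insert N K = S" unfolding fK using True p(2) S'S(3) by (simp add: v_def)
      thus ?thesis unfolding T_def by simp
    next
      case pn: False
      hence "flip p ` K = uminus ` S'" using fl pf by blast
      hence "f ` insert N K = insert (- N) (uminus ` S')" unfolding fK using pn p(2) by (simp add: v_def)
      also have "\<dots> = T" unfolding T_def S'S(3) by simp
      finally have "f ` insert N K = T" .
      moreover have "uminus ` T = S" by (simp add: T_def del: image_insert)
      ultimately show ?thesis by (simp only:) blast
    qed
    moreover have "core_lift (Suc m) f \<sigma> K = {f ` insert N K, uminus ` f ` insert N K} \<union> sym_lift f (\<sigma> - {K})"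
      unfolding core_lift_def sym_lift_def by (rule UN_insert)
    ultimately have "core_lift (Suc m) f \<sigma> K = \<pi>" unfolding fR piR by (simp only: Un_commute)
    moreover have "(THE B. B \<in> \<sigma> \<and> p \<in> B) = K"
      by (rule the_block[OF \<sigma> Ks]) (use p(1) in \<open>simp add: K_def\<close>)
    ultimately have "\<pi> = psi_inv (Suc m) (\<sigma>, MInt v)"
      unfolding psi_inv_def prod.case mark.case av(1) f_def by (simp only:)
    moreover have "(\<sigma>, MInt v) \<in> DD (Suc m)"
    proof -
      have "p \<in> {1..int m}" using p(1) Ksub by (auto simp: K_def)
      thus ?thesis using \<sigma> by (auto simp: DD_def v_def)
    qed
    ultimately show ?thesis by blast
  qed
qed

lemma psi_inv_surj: "\<exists>y\<in>DD (Suc m). \<pi> = psi_inv (Suc m) y"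
  using psi_inv_zero psi_inv_nonzero by blast

end

theorem theorem6p4:
  fixes n :: nat
  assumes "n \<ge> 2"
  shows "bij_betw (psiD n) (NCD n) (DD n) \<and>
    (\<forall>\<pi>\<in>NCD n. \<forall>\<sigma> x. psiD n \<pi> = (\<sigma>, x) \<longrightarrow>
      (x = MEmpty \<or> (\<exists>e. x = MEdge e) \<longrightarrow> typeB \<pi> = type_of \<sigma> + {#1#}) \<and>
      (\<forall>B. x = MBlock B \<longrightarrow> typeB \<pi> = type_of (\<sigma> - {B})) \<and>
      (\<forall>i B. x = MInt i \<and> B \<in> \<sigma> \<and> \<bar>i\<bar> \<in> B \<longrightarrow>
         typeB \<pi> = type_of (\<sigma> - {B}) + {#card B + 1#}))"
proof -
  obtain m where n: "n = Suc m" using assms by (cases n) auto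
  have f: "psi_inv n y \<in> NCD n" "psiD n (psi_inv n y) = y" "type_rule (psi_inv n y) y" if "y \<in> DD n" for y
    using psiD_psi_inv[of "fst y" "snd y" m] that unfolding n by auto
  have s: "\<exists>y\<in>DD n. \<pi> = psi_inv n y" if "\<pi> \<in> NCD n" for \<pi>
    using that NCD_partition.psi_inv_surj[of m \<pi>] unfolding n NCD_partition_def by blast
  have "bij_betw (psiD n) (NCD n) (DD n)"
  proof (rule bij_betw_byWitness[where f' = "psi_inv n"])
    \<comment> \<open>Writing \<pi> as a value of \<open>psi_inv n\<close> upgrades the right
      inverse to a two-sided one.\<close>
    show "\<forall>\<pi>\<in>NCD n. psi_inv n (psiD n \<pi>) = \<pi>" using s f(2) by metis
    show "\<forall>y\<in>DD n. psiD n (psi_inv n y) = y" using f(2) by blast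
    show "psiD n ` NCD n \<subseteq> DD n" using s f(2) by (metis image_subsetI)
    show "psi_inv n ` DD n \<subseteq> NCD n" using f(1) by blast
  qed
  moreover have "type_rule \<pi> (psiD n \<pi>)" if "\<pi> \<in> NCD n" for \<pi>
    using s[OF that] f(2,3) by metis
  hence "\<forall>\<pi>\<in>NCD n. \<forall>\<sigma> x. psiD n \<pi> = (\<sigma>, x) \<longrightarrow> type_rule \<pi> (\<sigma>, x)" by metis
  ultimately show ?thesis unfolding type_rule_def prod.case by blast
qed

end
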